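(* Let $\tfrac12<\lambda<1$ and let $T_\lambda\subset\mathbb{R}^2$ be the graph of the Takagi function with parameter $\lambda$. Then $$\max_{x\in T_\lambda,\ V\in\mathbb{RP}^1}\dim_{\mathrm H}(T_\lambda\cap(V+x))=\dim_{\mathrm A}(T_\lambda)-1<1;$$ in particular the maximum on the left-hand side exists.
   Context: For $\tfrac12<\lambda<1$ the Takagi function is $T_\lambda\colon[0,1]\to\mathbb{R}$, $T_\lambda(x)=\sum_{n=0}^\infty\lambda^n\,\mathrm{dist}(2^nx,\mathbb{Z})$. The same symbol $T_\lambda$ denotes its graph $\{(x,T_\lambda(x)):x\in[0,1]\}\subset\mathbb{R}^2$. $\mathbb{RP}^1$ is the set of all lines through the origin in $\mathbb{R}^2$, and $V+x$ is the translate of the line $V$ by $x$. $\dim_{\mathrm H}$ is the Hausdorff dimension. $\dim_{\mathrm A}(X)$ is the Assouad dimension: the infimum of $s>0$ for which there is $C>0$ such that $N_r(X\cap B(x,R))\le C(R/r)^s$ for all $x\in X$ and $0<r<R$, where $N_r(E)$ is the least number of closed balls of radius $r$ needed to cover $E$. *)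

theory Defs
  imports "HOL-Analysis.Analysis"
begin

definition takagi :: "real \<Rightarrow> real \<Rightarrow> real" where
  "takagi lam x = (\<Sum>n. lam ^ n * infdist (2 ^ n * x) \<int>)"

definition takagi_graph :: "real \<Rightarrow> (real \<times> real) set" where
  "takagi_graph lam = {(x, takagi lam x) | x. x \<in> {0..1}}"

definition RP1 :: "(real \<times> real) set set" where
  "RP1 = {V. subspace V \<and> dim V = 1}"

(* Meant for s > 0 only: since 0 powr 0 = 0, the value at s = 0 is not the counting measure.
   Boundedness is required because the real-valued diameter is meaningless on unbounded sets.
   Covers by countably many sets are sequences, possibly containing the empty set, which
   contributes 0. *)
definition hausdorff_premeasure :: "real \<Rightarrow> real \<Rightarrow> 'a::metric_space set \<Rightarrow> ennreal" where
  "hausdorff_premeasure s \<delta> E =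
     Inf {(\<Sum>i. ennreal (diameter (U i) powr s)) | U :: nat \<Rightarrow> 'a set.
            E \<subseteq> (\<Union>i. U i) \<and> (\<forall>i. bounded (U i) \<and> diameter (U i) \<le> \<delta>)}"

definition hausdorff_measure :: "real \<Rightarrow> 'a::metric_space set \<Rightarrow> ennreal" where
  "hausdorff_measure s E = (SUP \<delta>\<in>{0<..}. hausdorff_premeasure s \<delta> E)"

(* Both dimensions are extended reals, so that the infimum of an empty set of exponents is
   infinite. The empty set has dimension 0. *)
definition hausdorff_dim :: "'a::metric_space set \<Rightarrow> ereal" where
  "hausdorff_dim E = Inf {ereal s | s. s > 0 \<and> hausdorff_measure s E = 0}"

(* The centres may lie anywhere in the ambient space; the value is infinite if there is no
   finite cover. *)
definition covering_number :: "real \<Rightarrow> 'a::metric_space set \<Rightarrow> enat" where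
  "covering_number r E = Inf {enat (card C) | C. finite C \<and> E \<subseteq> (\<Union>c\<in>C. cball c r)}"

definition assouad_dim :: "'a::metric_space set \<Rightarrow> ereal" where
  "assouad_dim X = Inf {ereal s | s. s > 0 \<and>
     (\<exists>C>0. \<forall>x\<in>X. \<forall>r R. 0 < r \<and> r < R \<longrightarrow>
        ereal_of_enat (covering_number r (X \<inter> cball x R)) \<le> ereal (C * (R / r) powr s))}"

end

theory Submission
  imports Defs
begin

text \<open>
  Write \<open>T\<close> for the Takagi function.  It satisfies \<open>T (x / 2) = lam * T x + x / 2\<close> and
  \<open>T ((1 + x) / 2) = lam * T x + (1 - x) / 2\<close>, so the part of the graph over a dyadic interval of
  level \<open>n\<close>, called a piece, is an affine copy of the graph of width \<open>2 ^ - n\<close> and height about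
  \<open>lam ^ n\<close>.  Undoing the affine map of a piece (renormalising) turns a line of slope \<open>s\<close> into a line of
  slope \<open>(s \<plusminus> 1) / (2 * lam)\<close> at each level.  As \<open>2 * lam > 1\<close>, these maps contract, and as \<open>lam < 1\<close>,
  their attractor is the full interval of slopes of absolute value at most
  \<open>1 / (2 * lam - 1)\<close>.

  Let \<open>max_count n\<close> be the maximal number of pieces of level \<open>n\<close> that a line with slope in the attractor
  can meet.  Renormalisation makes it submultiplicative, so it grows like \<open>2 powr (growth * n)\<close> for a
  number \<open>growth\<close>.  Both sides of the claim are equal to \<open>growth\<close>.

  \<^item> No slice has larger dimension (\<open>hausdorff_dim_line_le\<close>).  Under repeated renormalisation every
    slope converges to the attractor, and a line whose slope is close to the attractor meets at most
    four times \<open>max_count n\<close> pieces of level \<open>n\<close>, because a piece is about as tall as the error.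

  \<^item> Some slice has this dimension (\<open>exists_critical_line\<close>, \<open>hausdorff_dim_critical_line\<close>).
    Otherwise every line would have an economical finite cover by pieces.  Such a cover is also good for
    all nearby lines, so by compactness finitely many of them suffice, and counting through them would
    make \<open>max_count\<close> grow more slowly than it does.

  \<^item> The Assouad dimension is at most \<open>1 + growth\<close> (\<open>assouad_dim_le\<close>).  Renormalising a piece whose
    width is comparable to the radius of a ball turns the ball into a thin neighbourhood of a line with slope in the
    attractor.  That line meets few subpieces, and each of them contributes at most a factor of
    about \<open>R / r\<close> for its vertical extent.  From the level on where subpieces are shorter than the
    ball, they are counted by their heights instead, which is no worse because
    \<open>2 * lam \<le> 2 powr growth\<close> (\<open>two_lam_le\<close>).

  \<^item> The Assouad dimension is at least \<open>1 + growth\<close> (\<open>assouad_dim_ge\<close>).  A line that meets \<open>max_count n\<close>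
    pieces can be lifted into a piece of arbitrarily high level \<open>m\<close> with its slope staying in the
    attractor.  Near the lifted line, at scale \<open>2 ^ - m\<close>, the subpieces that it meets are so tall
    that they look like vertical segments.

  Finally \<open>growth < 1\<close> (\<open>growth_less_1\<close>), since a line meeting all pieces of a fine level would be
  uniformly close to the graph, which is impossible as \<open>T 0 - 2 * T (1 / 2) + T 1 = -1\<close>.
\<close>

section \<open>Dyadic intervals, counting, and distance to the integers\<close>

lemma dyadic_point:
  assumes "i < 2 ^ m" "x \<in> {0..1}"
  shows "(real i + x) / 2 ^ m \<in> {0..1}"
proof -
  have "real i + 1 \<le> 2 ^ m" using assms(1)
    by (metis Suc_eq_plus1 Suc_leI of_nat_1 of_nat_add of_nat_le_iff of_nat_numeral of_nat_power)
  then show ?thesis using assms(2) by (auto simp: field_simps)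
qed

lemma dyadic_index:
  assumes "y \<in> {0..1::real}"
  obtains k x where "k < 2 ^ n" "x \<in> {0..1}" "y = (real k + x) / 2 ^ n"
proof (cases "y = 1")
  case True
  then show ?thesis using that[of "2 ^ n - 1" 1] by (simp add: of_nat_diff)
next
  case False
  define k where "k = nat \<lfloor>y * 2 ^ n\<rfloor>"
  have nn: "0 \<le> y * 2 ^ n" using assms by simp
  then have k: "real k = of_int \<lfloor>y * 2 ^ n\<rfloor>" by (simp add: k_def)
  have "y * 2 ^ n < 2 ^ n" using assms False by auto
  then have "real k < 2 ^ n" using k by linarith
  then have "k < 2 ^ n" by (metis of_nat_less_iff of_nat_numeral of_nat_power)
  moreover have "y * 2 ^ n - real k \<in> {0..1}" unfolding k by auto linarith
  ultimately show ?thesis using that[of k "y * 2 ^ n - real k"] by simp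
qed

lemma dyadic_child_point:
  "(real k + x) / 2 ^ (m + n) = (real (k div 2 ^ n) + (real (k mod 2 ^ n) + x) / 2 ^ n) / 2 ^ m"
proof -
  define i j where "i = k div 2 ^ n" and "j = k mod 2 ^ n"
  have "k = i * 2 ^ n + j" by (simp only: i_def j_def div_mult_mod_eq)
  then have "real k = real i * 2 ^ n + real j" by simp
  then show ?thesis unfolding i_def[symmetric] j_def[symmetric] by (simp add: field_simps power_add)
qed

lemma div_power_less: "k < 2 ^ (m + n) \<Longrightarrow> k div 2 ^ n < (2::nat) ^ m"
  by (simp add: less_mult_imp_div_less power_add)

lemma exists_dyadic_scale:
  assumes "0 < r" "r \<le> (1::real)"
  shows "\<exists>k. r * 2 ^ k \<le> 1 \<and> 1 < 2 * r * 2 ^ k"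
proof -
  define k where "k = nat \<lfloor>log 2 (1 / r)\<rfloor>"
  have nn: "0 \<le> log 2 (1 / r)" using assms by simp
  have "2 powr real k \<le> 2 powr log 2 (1 / r)" using nn unfolding k_def by (intro powr_mono) auto
  then have "r * 2 ^ k \<le> 1" using assms by (simp add: powr_realpow field_simps)
  moreover have "log 2 (1 / r) < real k + 1" using nn unfolding k_def by linarith
  then have "2 powr log 2 (1 / r) < 2 powr (real k + 1)" by (intro powr_less_mono) auto
  then have "1 < 2 * r * 2 ^ k" using assms by (simp add: powr_add powr_realpow field_simps)
  ultimately show ?thesis by blast
qed

lemma card_div_fibre: "card {v \<in> A. v div N = (u::nat)} \<le> N" if "0 < N" for A
proof (rule card_inj_on_le[where f = "\<lambda>v. v mod N" and B = "{..<N}", simplified card_lessThan])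
  show "inj_on (\<lambda>v. v mod N) {v \<in> A. v div N = u}"
    by (rule inj_onI) (metis (mono_tags, lifting) div_mult_mod_eq mem_Collect_eq)
qed (use that in auto)

lemma card_nat_near_le:
  "finite {j. \<bar>real j - a\<bar> \<le> r}" "0 \<le> r \<Longrightarrow> real (card {j. \<bar>real j - a\<bar> \<le> r}) \<le> 2 * r + 1"
proof -
  have sub: "int ` {j. \<bar>real j - a\<bar> \<le> r} \<subseteq> {\<lceil>a - r\<rceil>..\<lfloor>a + r\<rfloor>}"
    by (auto simp: ceiling_le_iff le_floor_iff)
  then have "finite (int ` {j. \<bar>real j - a\<bar> \<le> r})" by (rule finite_subset) simp
  then show fin: "finite {j. \<bar>real j - a\<bar> \<le> r}" by (rule finite_imageD) simp
  assume "0 \<le> r"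
  have "card {j. \<bar>real j - a\<bar> \<le> r} = card (int ` {j. \<bar>real j - a\<bar> \<le> r})"
    by (rule card_image[symmetric]) simp
  also have "\<dots> \<le> card {\<lceil>a - r\<rceil>..\<lfloor>a + r\<rfloor>}" by (rule card_mono[OF _ sub]) simp
  finally have "card {j. \<bar>real j - a\<bar> \<le> r} \<le> nat (\<lfloor>a + r\<rfloor> - \<lceil>a - r\<rceil> + 1)" by simp
  moreover have "real (nat (\<lfloor>a + r\<rfloor> - \<lceil>a - r\<rceil> + 1)) \<le> 2 * r + 1"
    using \<open>0 \<le> r\<close> by (cases "0 \<le> \<lfloor>a + r\<rfloor> - \<lceil>a - r\<rceil> + 1") linarith+
  ultimately show "real (card {j. \<bar>real j - a\<bar> \<le> r}) \<le> 2 * r + 1" by linarith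
qed

lemma sum_UN_le:
  fixes f :: "'b \<Rightarrow> real"
  assumes "finite I" "\<And>i. i \<in> I \<Longrightarrow> finite (A i)" "\<And>x. 0 \<le> f x"
  shows "sum f (\<Union>i\<in>I. A i) \<le> (\<Sum>i\<in>I. sum f (A i))"
  using assms(1,2)
proof (induction I rule: finite_induct)
  case (insert i I)
  have "sum f (A i \<union> (\<Union>i\<in>I. A i)) \<le> sum f (A i) + sum f (\<Union>i\<in>I. A i)"
    using insert by (subst sum.union_inter[symmetric]) (auto intro!: sum_nonneg assms(3))
  then show ?case using insert by simp
qed simp

lemma dist_prod_le: "dist (a, b) (c, d) \<le> \<bar>a - c\<bar> + \<bar>b - d\<bar>" for a b c d :: real
  unfolding dist_prod_def fst_conv snd_conv dist_real_def using sqrt_sum_squares_le_sum_abs by fastforce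

lemma le_of_power_bounded:
  fixes a b C :: real
  assumes "0 < b" and "\<And>n. a ^ n \<le> C * b ^ n"
  shows "a \<le> b"
proof (rule ccontr)
  assume "\<not> a \<le> b"
  then have "1 < a / b" using assms(1) by simp
  then obtain n where "C < (a / b) ^ n" using real_arch_pow by blast
  then show False using assms(2)[of n] assms(1) by (simp add: power_divide field_simps)
qed

lemma powr_mult_nat: "0 < a \<Longrightarrow> a powr (t * real n) = (a powr t) ^ n"
  by (simp add: powr_powr[symmetric] powr_realpow)

lemma infdist_Ints_le_1: "infdist (x::real) \<int> \<le> 1"
proof -
  have "infdist x \<int> \<le> dist x (of_int \<lfloor>x\<rfloor>)" by (rule infdist_le) auto
  also have "\<dots> \<le> 1" unfolding dist_real_def by linarith
  finally show ?thesis .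
qed

lemma infdist_Ints_add_1: "infdist (x + 1::real) \<int> = infdist x \<int>"
proof -
  have le: "infdist (x + of_int k) \<int> \<le> infdist x \<int>" for x :: real and k
  proof -
    have ne: "(\<int>::real set) \<noteq> {}" by auto
    show ?thesis unfolding infdist_notempty[OF ne]
    proof (rule cINF_greatest[OF ne])
      fix a :: real assume "a \<in> \<int>"
      then have "a + of_int k \<in> \<int>" by simp
      then have "(INF a\<in>\<int>. dist (x + of_int k) a) \<le> dist (x + of_int k) (a + of_int k)"
        by (intro cINF_lower bdd_belowI2[where m = 0]) auto
      then show "(INF a\<in>\<int>. dist (x + of_int k) a) \<le> dist x a" by simp
    qed
  qed
  from le[of x 1] le[of "x + 1" "-1"] show ?thesis by simp
qed

lemma infdist_Ints_low:
  assumes "0 \<le> x" "x \<le> 1/2" shows "infdist (x::real) \<int> = x"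
proof (rule antisym)
  show "infdist x \<int> \<le> x" using infdist_le[of 0 \<int> x] assms by (simp add: dist_real_def)
  have ne: "(\<int>::real set) \<noteq> {}" by auto
  show "x \<le> infdist x \<int>" unfolding infdist_notempty[OF ne]
  proof (rule cINF_greatest[OF ne])
    fix a :: real assume "a \<in> \<int>"
    then obtain k where "a = of_int k" by (auto elim: Ints_cases)
    then show "x \<le> dist x a" using assms unfolding dist_real_def
      by (cases "k \<le> 0"; linarith)
  qed
qed

lemma infdist_Ints_high:
  assumes "1/2 \<le> x" "x \<le> 1" shows "infdist (x::real) \<int> = 1 - x"
proof (rule antisym)
  show "infdist x \<int> \<le> 1 - x" using infdist_le[of 1 \<int> x] assms by (simp add: dist_real_def)
  have ne: "(\<int>::real set) \<noteq> {}" by auto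
  show "1 - x \<le> infdist x \<int>" unfolding infdist_notempty[OF ne]
  proof (rule cINF_greatest[OF ne])
    fix a :: real assume "a \<in> \<int>"
    then obtain k where "a = of_int k" by (auto elim: Ints_cases)
    then show "1 - x \<le> dist x a" using assms unfolding dist_real_def
      by (cases "k \<le> 0"; linarith)
  qed
qed

section \<open>Self-affinity of the Takagi function\<close>

locale takagi_parameter =
  fixes lam :: real
  assumes lam_gt: "1 / 2 < lam" and lam_lt: "lam < 1"
begin

abbreviation "T \<equiv> takagi lam"

definition "T_bound = 1 / (1 - lam)"

definition "slope_bound = 1 / (2 * lam - 1)"

lemma lam_pos [simp]: "0 < lam" and lam_nonneg [simp]: "0 \<le> lam" and lam_neq_0 [simp]: "lam \<noteq> 0"
  using lam_gt by linarith+

lemma T_bound_ge: "1 < T_bound"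
  using lam_gt lam_lt by (simp add: T_bound_def field_simps)

lemma slope_bound_ge: "1 < slope_bound"
  using lam_gt lam_lt by (simp add: slope_bound_def field_simps)

lemma term_bound: fixes x :: real shows "\<bar>lam ^ n * infdist (2 ^ n * x) \<int>\<bar> \<le> lam ^ n"
  using infdist_Ints_le_1[of "2 ^ n * x"] by (simp add: abs_mult infdist_nonneg mult_left_le)

lemma summable_lam: "summable (\<lambda>n. lam ^ n)"
  using lam_lt by (simp add: summable_geometric)

lemma summable_T: fixes x :: real shows "summable (\<lambda>n. lam ^ n * infdist (2 ^ n * x) \<int>)"
  by (rule summable_comparison_test'[OF summable_lam, of 0]) (use term_bound in auto)

lemma T_nonneg: "0 \<le> T x"
  unfolding takagi_def by (intro suminf_nonneg summable_T) (simp add: infdist_nonneg)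

lemma T_le: "T x \<le> T_bound"
proof -
  have "T x \<le> (\<Sum>n. lam ^ n)"
    unfolding takagi_def using term_bound[of _ x]
    by (intro suminf_le summable_T summable_lam) (auto simp: abs_le_iff)
  then show ?thesis using lam_lt by (simp add: T_bound_def suminf_geometric)
qed

lemma continuous_on_T: "continuous_on A T"
proof -
  have "uniform_limit UNIV (\<lambda>n (x::real). \<Sum>i<n. lam ^ i * infdist (2 ^ i * x) \<int>)
      (\<lambda>x. \<Sum>i. lam ^ i * infdist (2 ^ i * x) \<int>) sequentially"
    by (rule Weierstrass_m_test[OF _ summable_lam]) (use term_bound in auto)
  then have "uniform_limit UNIV (\<lambda>n x. \<Sum>i<n. lam ^ i * infdist (2 ^ i * x) \<int>) T sequentially"
    unfolding takagi_def[abs_def] .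
  then have "continuous_on UNIV T"
    by (rule uniform_limit_theorem[rotated]) (auto intro!: always_eventually continuous_intros)
  then show ?thesis by (rule continuous_on_subset) simp
qed

lemma T_unfold: "T x = infdist x \<int> + lam * T (2 * x)"
proof -
  have "T x = (\<Sum>n. lam ^ Suc n * infdist (2 ^ Suc n * x) \<int>) + infdist x \<int>"
    unfolding takagi_def using suminf_split_head[OF summable_T[of x]] by simp
  also have "(\<Sum>n. lam ^ Suc n * infdist (2 ^ Suc n * x) \<int>) = lam * T (2 * x)"
    unfolding takagi_def using suminf_mult[OF summable_T[of "2*x"], of lam]
    by (simp add: mult_ac)
  finally show ?thesis by simp
qed

lemma T_add_1: "T (x + 1) = T x"
proof -
  have "infdist (x + of_nat k) \<int> = infdist (x::real) \<int>" for x k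
    by (induction k) (auto simp: infdist_Ints_add_1 add.assoc[symmetric] add.commute[of 1])
  from this[of _ "2 ^ n" for n] show ?thesis unfolding takagi_def by (simp add: ring_distribs)
qed

lemma T_left_half: "0 \<le> x \<Longrightarrow> x \<le> 1 \<Longrightarrow> T (x / 2) = lam * T x + x / 2"
  using T_unfold[of "x / 2"] by (simp add: infdist_Ints_low)

lemma T_right_half: "0 \<le> x \<Longrightarrow> x \<le> 1 \<Longrightarrow> T ((1 + x) / 2) = lam * T x + (1 - x) / 2"
  using T_unfold[of "(1 + x) / 2"] T_add_1[of x] infdist_Ints_high[of "(1 + x) / 2"]
  by (simp add: add.commute diff_divide_distrib add_divide_distrib)

lemma T_0: "T 0 = 0" and T_1: "T 1 = 0" and T_half: "T (1 / 2) = 1 / 2"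
proof -
  have "(1 - lam) * T 0 = 0" using T_left_half[of 0] by (simp add: algebra_simps)
  then show "T 0 = 0" using lam_lt by simp
  then show "T 1 = 0" using T_add_1[of 0] by simp
  then show "T (1 / 2) = 1 / 2" using T_left_half[of 1] by simp
qed

text \<open>Iterating the two functional equations, the graph over a dyadic interval of level \<open>m\<close> is an
  affine copy of the whole graph.  Subtracting a line of slope \<open>s\<close> and undoing the copy leaves
  a line whose slope has been contracted towards the interval between \<open>- slope_bound\<close> and
  \<open>slope_bound\<close>, the attractor of \<open>s \<mapsto> (s \<plusminus> 1) / (2 * lam)\<close>.\<close>

lemma T_dyadic_affine:
  assumes "i < 2 ^ m"
  shows "\<exists>a. \<bar>a\<bar> \<le> slope_bound * (1 - 1 / (2 * lam) ^ m) \<and>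
    (\<exists>b. \<forall>x\<in>{0..1}. T ((real i + x) / 2 ^ m) = lam ^ m * (T x + a * x + b))"
  using assms
proof (induction m arbitrary: i)
  case 0
  then show ?case by (intro exI[of _ 0]) (auto intro!: exI[of _ 0])
next
  case (Suc m)
  define e where "e = (if even i then 1 else -1 :: real)"
  have half: "T ((real (i mod 2) + x) / 2) = lam * T x + e * x / 2 + (1 - e) / 4"
    if "x \<in> {0..1}" for x
  proof (cases "even i")
    case True
    then show ?thesis using T_left_half[of x] that by (simp add: e_def even_iff_mod_2_eq_zero)
  next
    case False
    then have "i mod 2 = 1" by presburger
    then show ?thesis using T_right_half[of x] that False by (simp add: e_def field_simps)
  qed
  have "i div 2 < 2 ^ m" using Suc.prems by auto
  from Suc.IH[OF this] obtain a b where a: "\<bar>a\<bar> \<le> slope_bound * (1 - 1 / (2 * lam) ^ m)"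
    and b: "\<And>x. x \<in> {0..1} \<Longrightarrow> T ((real (i div 2) + x) / 2 ^ m) = lam ^ m * (T x + a * x + b)"
    by blast
  have i: "real i = 2 * real (i div 2) + real (i mod 2)"
    by (metis of_nat_add of_nat_mult of_nat_numeral mult_div_mod_eq)
  have "T ((real i + x) / 2 ^ Suc m)
      = lam ^ Suc m * (T x + ((a + e) / (2 * lam)) * x
          + (a * real (i mod 2) / 2 + b + (1 - e) / 4) / lam)" if x: "x \<in> {0..1}" for x
  proof -
    have y: "(real (i mod 2) + x) / 2 \<in> {0..1}" using x by (cases "even i") (auto simp: odd_iff_mod_2_eq_one)
    have "(real i + x) / 2 ^ Suc m = (real (i div 2) + (real (i mod 2) + x) / 2) / 2 ^ m"
      by (subst i) (simp add: field_simps)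
    moreover have "lam ^ m * (T x * lam + e * x / 2 + (1 - e) / 4 + a * ((real (i mod 2) + x) / 2) + b)
      = lam ^ Suc m * (T x + ((a + e) / (2 * lam)) * x
          + (a * real (i mod 2) / 2 + b + (1 - e) / 4) / lam)"
      by (simp add: ring_distribs add_divide_distrib) (simp add: field_simps)
    ultimately show ?thesis using b[OF y] half[OF x] by (simp add: mult.commute)
  qed
  moreover have "\<bar>(a + e) / (2 * lam)\<bar> \<le> slope_bound * (1 - 1 / (2 * lam) ^ Suc m)"
  proof -
    have "\<bar>(a + e) / (2 * lam)\<bar> \<le> (slope_bound * (1 - 1 / (2 * lam) ^ m) + 1) / (2 * lam)"
      using a by (simp add: divide_right_mono e_def)
    also have "\<dots> = slope_bound * (1 - 1 / (2 * lam) ^ Suc m)"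
      using lam_gt by (simp add: slope_bound_def field_simps)
    finally show ?thesis .
  qed
  ultimately show ?case by blast
qed

lemma dyadic_renormalisation:
  assumes "i < 2 ^ m"
  shows "\<exists>a. \<bar>a\<bar> \<le> slope_bound * (1 - 1 / (2 * lam) ^ m) \<and>
    (\<forall>s c. \<exists>c'. \<forall>x\<in>{0..1}. T ((real i + x) / 2 ^ m) - s * ((real i + x) / 2 ^ m) - c
       = lam ^ m * (T x - (s / (2 * lam) ^ m - a) * x - c'))"
proof -
  obtain a b where a: "\<bar>a\<bar> \<le> slope_bound * (1 - 1 / (2 * lam) ^ m)"
    and b: "\<And>x. x \<in> {0..1} \<Longrightarrow> T ((real i + x) / 2 ^ m) = lam ^ m * (T x + a * x + b)"
    using T_dyadic_affine[OF assms] by blast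
  have "T ((real i + x) / 2 ^ m) - s * ((real i + x) / 2 ^ m) - c
       = lam ^ m * (T x - (s / (2 * lam) ^ m - a) * x - ((s * real i / 2 ^ m + c) / lam ^ m - b))"
    if "x \<in> {0..1}" for s c x
  proof -
    have "s * ((real i + x) / 2 ^ m) = s * real i / 2 ^ m + s / 2 ^ m * x"
      by (simp add: field_simps)
    moreover have "lam ^ m * ((s * real i / 2 ^ m + c) / lam ^ m) = s * real i / 2 ^ m + c"
      by simp
    ultimately show ?thesis
      by (simp add: b[OF that] power_mult_distrib right_diff_distrib distrib_left left_diff_distrib)
  qed
  then show ?thesis using a by blast
qed

lemma slope_renormalised_bounded:
  assumes "\<bar>a\<bar> \<le> slope_bound * (1 - 1 / (2 * lam) ^ m)" "\<bar>s\<bar> \<le> slope_bound"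
  shows "\<bar>s / (2 * lam) ^ m - a\<bar> \<le> slope_bound"
proof -
  have "\<bar>s / (2 * lam) ^ m - a\<bar> \<le> \<bar>s\<bar> / (2 * lam) ^ m + \<bar>a\<bar>"
    using abs_triangle_ineq4[of "s / (2 * lam) ^ m" a] by (simp add: abs_mult power_abs)
  also have "\<dots> \<le> slope_bound / (2 * lam) ^ m + slope_bound * (1 - 1 / (2 * lam) ^ m)"
    using assms by (intro add_mono divide_right_mono) auto
  finally show ?thesis by (simp add: algebra_simps)
qed

text \<open>The interval of slopes bounded by \<open>slope_bound\<close> is the union of its two images under the
  contractions \<open>s \<mapsto> (s \<plusminus> 1) / (2 * lam)\<close>, because \<open>lam < 1\<close>.  Hence for every slope in the interval
  one of the two inverse maps leads back into the interval, and a line can be lifted into pieces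
  of any level without its slope growing.\<close>

lemma slope_lift:
  assumes "\<bar>s\<bar> \<le> slope_bound"
  shows "\<exists>j < 2 ^ m. \<exists>s'. \<bar>s'\<bar> \<le> slope_bound \<and> (\<exists>c'. \<forall>x\<in>{0..1}.
     T ((real j + x) / 2 ^ m) - s' * ((real j + x) / 2 ^ m) - c' = lam ^ m * (T x - s * x))"
  using assms
proof (induction m arbitrary: s)
  case 0
  have "\<forall>x\<in>{0..1}. T ((real 0 + x) / 2 ^ 0) - s * ((real 0 + x) / 2 ^ 0) - 0
      = lam ^ 0 * (T x - s * x)" by simp
  with 0 show ?case
    by (intro exI[of _ "0::nat"] conjI exI[of _ s] exI[of _ 0]) auto
next
  case (Suc m)
  define e where "e = (if s \<le> 0 then 1 else -1 :: real)"
  define d where "d = (if s \<le> 0 then 0 else 1 :: nat)"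
  have sb: "slope_bound * (2 * lam) = slope_bound + 1"
    using lam_gt by (simp add: slope_bound_def field_simps)
  have half: "T ((real d + x) / 2) = lam * T x + e * x / 2 + (1 - e) / 4"
    if "x \<in> {0..1}" for x
    using T_left_half[of x] T_right_half[of x] that by (auto simp: d_def e_def field_simps)
  have "2 * lam * \<bar>s\<bar> \<le> 2 * lam * slope_bound" using Suc.prems by (intro mult_left_mono) auto
  also have "\<dots> = slope_bound + 1" using sb by (simp only: mult.commute)
  finally have 2: "2 * lam * \<bar>s\<bar> \<le> slope_bound + 1" .
  have "\<bar>2 * lam * s + e\<bar> \<le> slope_bound"
  proof (cases "s \<le> 0")
    case True
    then have "2 * lam * s \<le> 0" by (simp add: mult_nonneg_nonpos)
    then show ?thesis unfolding e_def using 2 True slope_bound_ge by simp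
  next
    case False
    then have "0 \<le> 2 * lam * s" by simp
    then show ?thesis unfolding e_def using 2 False slope_bound_ge by (simp only: if_False)
  qed
  from Suc.IH[OF this] obtain j s' c' where j: "j < 2 ^ m" and s': "\<bar>s'\<bar> \<le> slope_bound"
    and c': "\<And>x. x \<in> {0..1} \<Longrightarrow> T ((real j + x) / 2 ^ m) - s' * ((real j + x) / 2 ^ m) - c'
       = lam ^ m * (T x - (2 * lam * s + e) * x)" by blast
  have "T ((real (2 * j + d) + x) / 2 ^ Suc m) - s' * ((real (2 * j + d) + x) / 2 ^ Suc m)
       - (c' + lam ^ m * ((1 - e) / 4 - (2 * lam * s + e) * real d / 2))
       = lam ^ Suc m * (T x - s * x)" if x: "x \<in> {0..1}" for x
  proof -
    have y: "(real d + x) / 2 \<in> {0..1}" using x by (auto simp: d_def)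
    have "(real (2 * j + d) + x) / 2 ^ Suc m = (real j + (real d + x) / 2) / 2 ^ m"
      by (simp add: field_simps)
    moreover have "T ((real j + (real d + x) / 2) / 2 ^ m)
       = s' * ((real j + (real d + x) / 2) / 2 ^ m) + c'
          + lam ^ m * (T ((real d + x) / 2) - (2 * lam * s + e) * ((real d + x) / 2))"
      using c'[OF y] by (simp add: algebra_simps)
    moreover have "T ((real d + x) / 2) - (2 * lam * s + e) * ((real d + x) / 2)
       - ((1 - e) / 4 - (2 * lam * s + e) * real d / 2) = lam * (T x - s * x)"
      unfolding half[OF x] by (simp add: field_simps)
    ultimately show ?thesis by (simp add: right_diff_distrib[symmetric] mult.assoc mult.left_commute)
  qed
  moreover have "2 * j + d < 2 ^ Suc m" using j by (auto simp: d_def)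
  ultimately show ?case using s' by blast
qed

section \<open>Counting the dyadic pieces that meet a line\<close>

text \<open>The point \<open>x \<in> {0..1}\<close> of the dyadic interval number \<open>k\<close> of level \<open>n\<close> is
  \<open>(k + x) / 2 ^ n\<close>; the value below is the height of the graph above the line of slope \<open>s\<close>
  through the origin.\<close>

definition height :: "real \<Rightarrow> nat \<Rightarrow> nat \<Rightarrow> real \<Rightarrow> real" where
  "height s n k x = T ((real k + x) / 2 ^ n) - s * ((real k + x) / 2 ^ n)"

definition near :: "real \<Rightarrow> real \<Rightarrow> real \<Rightarrow> nat \<Rightarrow> nat set" where
  "near s c h n = {k. k < 2 ^ n \<and> (\<exists>x\<in>{0..1}. \<bar>height s n k x - c\<bar> \<le> h)}"

lemma finite_near [simp]: "finite (near s c h n)"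
  by (rule finite_subset[of _ "{..<2 ^ n}"]) (auto simp: near_def)

lemma card_near_le: "card (near s c h n) \<le> 2 ^ n"
  using card_mono[of "{..<2 ^ n}" "near s c h n"] by (auto simp: near_def)

lemma height_renormalised:
  assumes "i < 2 ^ m"
  shows "\<exists>a. \<bar>a\<bar> \<le> slope_bound * (1 - 1 / (2 * lam) ^ m) \<and>
    (\<forall>s. \<exists>d. \<forall>x\<in>{0..1}. height s m i x = lam ^ m * (T x - (s / (2 * lam) ^ m - a) * x - d))"
proof -
  obtain a where a: "\<bar>a\<bar> \<le> slope_bound * (1 - 1 / (2 * lam) ^ m)"
    "\<forall>s c. \<exists>c'. \<forall>x\<in>{0..1}. T ((real i + x) / 2 ^ m) - s * ((real i + x) / 2 ^ m) - c
       = lam ^ m * (T x - (s / (2 * lam) ^ m - a) * x - c')"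
    using dyadic_renormalisation[OF assms] by (elim exE conjE) (rule that)
  show ?thesis
  proof (rule exI[of _ a], intro conjI allI a(1))
    fix s
    show "\<exists>d. \<forall>x\<in>{0..1}. height s m i x = lam ^ m * (T x - (s / (2 * lam) ^ m - a) * x - d)"
      using a(2)[rule_format, of s 0] by (simp add: height_def)
  qed
qed

lemma height_child:
  "height s (m + n) k x = height s m (k div 2 ^ n) ((real (k mod 2 ^ n) + x) / 2 ^ n)"
  by (simp add: height_def dyadic_child_point)

lemma near_ancestor:
  assumes "k \<in> near s c h (m + n)"
  shows "k div 2 ^ n \<in> near s c h m"
proof -
  from assms obtain x where k: "k < 2 ^ (m + n)" and x: "x \<in> {0..1}"
    and h: "\<bar>height s (m + n) k x - c\<bar> \<le> h" by (auto simp: near_def)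
  have "(real (k mod 2 ^ n) + x) / 2 ^ n \<in> {0..1}" using x by (intro dyadic_point) auto
  then show ?thesis using h div_power_less[OF k] unfolding near_def height_child by blast
qed

text \<open>A line that has been renormalised by the piece \<open>i\<close> of level \<open>m\<close> sees the descendants of
  that piece as pieces of the whole graph.\<close>

lemma near_descendants:
  assumes "i < 2 ^ m"
  shows "\<exists>a. \<bar>a\<bar> \<le> slope_bound * (1 - 1 / (2 * lam) ^ m) \<and>
    (\<forall>s c. \<exists>c'. \<forall>h n. card {k \<in> near s c h (m + n). k div 2 ^ n = i}
       \<le> card (near (s / (2 * lam) ^ m - a) c' (h / lam ^ m) n))"
proof -
  obtain a where a: "\<bar>a\<bar> \<le> slope_bound * (1 - 1 / (2 * lam) ^ m)"
    and d: "\<forall>s. \<exists>d. \<forall>x\<in>{0..1}. height s m i x = lam ^ m * (T x - (s / (2 * lam) ^ m - a) * x - d)"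
    using height_renormalised[OF assms] by (elim exE conjE) (rule that)
  show ?thesis
  proof (rule exI[of _ a], intro conjI allI a)
    fix s c
    define s' where "s' = s / (2 * lam) ^ m - a"
    obtain d where d: "\<And>x. x \<in> {0..1} \<Longrightarrow> height s m i x = lam ^ m * (T x - s' * x - d)"
      using d[THEN spec, of s] unfolding s'_def by blast
    define c' where "c' = d + c / lam ^ m"
    have "card {k \<in> near s c h (m + n). k div 2 ^ n = i} \<le> card (near s' c' (h / lam ^ m) n)" for h n
    proof (rule card_inj_on_le[where f = "\<lambda>k. k mod 2 ^ n"])
      show "inj_on (\<lambda>k. k mod 2 ^ n) {k \<in> near s c h (m + n). k div 2 ^ n = i}"
        by (rule inj_onI) (metis (mono_tags, lifting) div_mult_mod_eq mem_Collect_eq)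
      show "(\<lambda>k. k mod 2 ^ n) ` {k \<in> near s c h (m + n). k div 2 ^ n = i} \<subseteq> near s' c' (h / lam ^ m) n"
      proof clarify
        fix k assume "k \<in> near s c h (m + n)" and i: "i = k div 2 ^ n"
        then obtain x where x: "x \<in> {0..1}" and h: "\<bar>height s (m + n) k x - c\<bar> \<le> h"
          by (auto simp: near_def)
        have y: "(real (k mod 2 ^ n) + x) / 2 ^ n \<in> {0..1}" using x by (intro dyadic_point) auto
        have "height s (m + n) k x - c = lam ^ m * (height s' n (k mod 2 ^ n) x - c')"
          unfolding height_child i[symmetric] d[OF y]
          by (simp add: height_def c'_def right_diff_distrib distrib_left)
        then have "lam ^ m * \<bar>height s' n (k mod 2 ^ n) x - c'\<bar> \<le> h" using h by (simp add: abs_mult)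
        then have "\<bar>height s' n (k mod 2 ^ n) x - c'\<bar> \<le> h / lam ^ m" by (simp add: field_simps)
        then show "k mod 2 ^ n \<in> near s' c' (h / lam ^ m) n" using x by (auto simp: near_def)
      qed
    qed simp
    then show "\<exists>c'. \<forall>h n. card {k \<in> near s c h (m + n). k div 2 ^ n = i}
       \<le> card (near (s / (2 * lam) ^ m - a) c' (h / lam ^ m) n)" unfolding s'_def by blast
  qed
qed

lemma card_near_split:
  assumes "\<And>i. i \<in> near s c h m \<Longrightarrow> card {k \<in> near s c h (m + n). k div 2 ^ n = i} \<le> Q"
  shows "card (near s c h (m + n)) \<le> card (near s c h m) * Q"
proof -
  have "card (near s c h (m + n)) \<le> card (\<Union>i\<in>near s c h m. {k \<in> near s c h (m + n). k div 2 ^ n = i})"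
    using near_ancestor by (intro card_mono) auto
  also have "\<dots> \<le> (\<Sum>i\<in>near s c h m. card {k \<in> near s c h (m + n). k div 2 ^ n = i})"
    by (rule card_UN_le) simp
  also have "\<dots> \<le> (\<Sum>i\<in>near s c h m. Q)" by (intro sum_mono assms)
  finally show ?thesis by simp
qed

definition max_count :: "nat \<Rightarrow> nat" where
  "max_count n = Max {card (near s c 0 n) | s c. \<bar>s\<bar> \<le> slope_bound}"

lemma max_count_set:
  "finite {card (near s c 0 n) | s c. \<bar>s\<bar> \<le> slope_bound}"
  "{card (near s c 0 n) | s c. \<bar>s\<bar> \<le> slope_bound} \<noteq> {}"
proof -
  show "finite {card (near s c 0 n) | s c. \<bar>s\<bar> \<le> slope_bound}"
    by (rule finite_subset[of _ "{..2 ^ n}"]) (auto simp: card_near_le)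
  have "\<bar>0\<bar> \<le> slope_bound" using slope_bound_ge by simp
  then show "{card (near s c 0 n) | s c. \<bar>s\<bar> \<le> slope_bound} \<noteq> {}" by blast
qed

lemma card_near_le_max_count:
  "\<bar>s\<bar> \<le> slope_bound \<Longrightarrow> card (near s c 0 n) \<le> max_count n"
  unfolding max_count_def by (rule Max_ge[OF max_count_set(1)]) blast

lemma max_count_attained:
  obtains s c where "\<bar>s\<bar> \<le> slope_bound" "card (near s c 0 n) = max_count n"
proof -
  have "max_count n \<in> {card (near s c 0 n) | s c. \<bar>s\<bar> \<le> slope_bound}"
    unfolding max_count_def by (rule Max_in[OF max_count_set])
  then show ?thesis using that by fastforce
qed

lemma max_count_le: "max_count n \<le> 2 ^ n"
  by (metis max_count_attained card_near_le)

lemma max_count_pos: "0 < max_count n"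
proof -
  have "0 \<in> near 0 0 0 n" unfolding near_def height_def
    by (auto intro!: bexI[of _ 0] simp: T_0)
  then have "0 < card (near 0 0 0 n)" by (auto simp: card_gt_0_iff)
  also have "\<dots> \<le> max_count n" using slope_bound_ge by (intro card_near_le_max_count) simp
  finally show ?thesis .
qed

lemma card_descendants_le:
  assumes "\<bar>s\<bar> \<le> slope_bound"
  shows "card {k \<in> near s c 0 (m + n). k div 2 ^ n = i} \<le> max_count n"
proof (cases "i < 2 ^ m")
  case True
  obtain a where a: "\<bar>a\<bar> \<le> slope_bound * (1 - 1 / (2 * lam) ^ m)"
    "\<forall>s c. \<exists>c'. \<forall>h n. card {k \<in> near s c h (m + n). k div 2 ^ n = i}
       \<le> card (near (s / (2 * lam) ^ m - a) c' (h / lam ^ m) n)"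
    using near_descendants[OF True] by (elim exE conjE) (rule that)
  then obtain c' where "card {k \<in> near s c 0 (m + n). k div 2 ^ n = i}
      \<le> card (near (s / (2 * lam) ^ m - a) c' (0 / lam ^ m) n)" by meson
  also have "\<dots> \<le> max_count n"
    using card_near_le_max_count[OF slope_renormalised_bounded[OF a(1) assms]] by simp
  finally show ?thesis .
next
  case False
  then have "{k \<in> near s c 0 (m + n). k div 2 ^ n = i} = {}"
    using div_power_less by (auto simp: near_def)
  then show ?thesis by (metis card.empty le0)
qed

text \<open>This is the reason for restricting \<open>max_count\<close> to slopes in the attractor: the restriction is
  preserved by renormalisation, so that each of the pieces of level \<open>m\<close> that are met contributes at
  most \<open>max_count n\<close> descendants.\<close>

lemma max_count_submultiplicative: "max_count (m + n) \<le> max_count m * max_count n"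
proof -
  obtain s c where s: "\<bar>s\<bar> \<le> slope_bound" and c: "card (near s c 0 (m + n)) = max_count (m + n)"
    by (rule max_count_attained)
  have "card (near s c 0 (m + n)) \<le> card (near s c 0 m) * max_count n"
    by (intro card_near_split card_descendants_le s)
  also have "\<dots> \<le> max_count m * max_count n" using card_near_le_max_count[OF s] by simp
  finally show ?thesis using c by simp
qed

lemma continuous_on_height: "continuous_on A (height s n k)"
  unfolding height_def[abs_def]
  by (intro continuous_intros continuous_on_compose2[OF continuous_on_T[of UNIV]]) auto

text \<open>The graph over a dyadic interval of level \<open>n\<close> is at least \<open>lam ^ n / 2\<close> tall relative to any
  line: its second difference at the endpoints and the midpoint is \<open>lam ^ n\<close> in absolute value,
  and adding an affine function leaves it unchanged.  Since the relative heights form an interval,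
  any point of the piece lies in a window of length \<open>lam ^ n / 2\<close> consisting of such heights.\<close>

lemma height_window:
  assumes k: "k < 2 ^ n" and x: "x \<in> {0..1}"
  obtains p where "p \<le> height s n k x" "height s n k x \<le> p + lam ^ n / 2"
    "{p..p + lam ^ n / 2} \<subseteq> height s n k ` {0..1}"
proof -
  obtain a where "\<forall>s. \<exists>d. \<forall>x\<in>{0..1}. height s n k x = lam ^ n * (T x - (s / (2 * lam) ^ n - a) * x - d)"
    using height_renormalised[OF k] by (elim exE conjE) (rule that)
  from this[THEN spec, of s] obtain s' d where d: "\<And>x. x \<in> {0..1} \<Longrightarrow> height s n k x = lam ^ n * (T x - s' * x - d)"
    by blast
  have "\<exists>x1\<in>{0..1}. height s n k x1 + lam ^ n / 2 \<le> height s n k (1 / 2)"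
  proof (cases "s' \<le> 0")
    case True
    then have "lam ^ n * s' \<le> 0" by (simp add: mult_nonneg_nonpos)
    then show ?thesis by (intro bexI[of _ 0]) (auto simp: d T_0 T_half algebra_simps)
  next
    case False
    then show ?thesis by (intro bexI[of _ 1]) (auto simp: d T_1 T_half algebra_simps)
  qed
  then obtain x1 where x1: "x1 \<in> {0..1}" "height s n k x1 + lam ^ n / 2 \<le> height s n k (1 / 2)" by blast
  have conn: "connected (height s n k ` {0..1})"
    by (intro connected_continuous_image continuous_on_height) auto
  have sub: "{height s n k u..height s n k v} \<subseteq> height s n k ` {0..1}"
    if "u \<in> {0..1}" "v \<in> {0..1}" for u v
    using connected_contains_Icc[OF conn] that by blast
  have half: "1 / 2 \<in> {0..1::real}" by simp
  define l where "l = lam ^ n / 2"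
  note x1' = x1(2)[folded l_def]
  have l: "l > 0" by (simp add: l_def)
  consider "height s n k x + l \<le> height s n k (1 / 2)" | "height s n k (1 / 2) \<le> height s n k x"
    | "height s n k (1 / 2) - l \<le> height s n k x" "height s n k x \<le> height s n k (1 / 2)" by linarith
  then show ?thesis
  proof cases
    case 1
    then show ?thesis using that[of "height s n k x", folded l_def] sub[OF x half] l by fastforce
  next
    case 2
    have "{height s n k x - l..height s n k x - l + l} \<subseteq> {height s n k x1..height s n k x}"
      using 2 x1' by auto
    then show ?thesis using that[of "height s n k x - l", folded l_def] sub[OF x1(1) x] l by fastforce
  next
    case 3
    have "{height s n k (1 / 2) - l..height s n k (1 / 2) - l + l} \<subseteq> {height s n k x1..height s n k (1 / 2)}"
      using x1' by auto
    then show ?thesis using that[of "height s n k (1 / 2) - l", folded l_def] sub[OF x1(1) half] 3 by fastforce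
  qed
qed

lemma height_variation:
  assumes k: "k < 2 ^ n" and s: "\<bar>s\<bar> \<le> slope_bound" and x: "x \<in> {0..1}" "y \<in> {0..1}"
  shows "\<bar>height s n k x - height s n k y\<bar> \<le> lam ^ n * (T_bound + slope_bound)"
proof -
  obtain a where a: "\<bar>a\<bar> \<le> slope_bound * (1 - 1 / (2 * lam) ^ n)"
    "\<forall>s. \<exists>d. \<forall>x\<in>{0..1}. height s n k x = lam ^ n * (T x - (s / (2 * lam) ^ n - a) * x - d)"
    using height_renormalised[OF k] by (elim exE conjE) (rule that)
  define s' where "s' = s / (2 * lam) ^ n - a"
  have s': "\<bar>s'\<bar> \<le> slope_bound" unfolding s'_def by (rule slope_renormalised_bounded[OF a(1) s])
  obtain d where d: "\<And>x. x \<in> {0..1} \<Longrightarrow> height s n k x = lam ^ n * (T x - s' * x - d)"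
    using a(2)[THEN spec, of s] unfolding s'_def by blast
  have "\<bar>s' * (x - y)\<bar> \<le> slope_bound * 1"
    unfolding abs_mult using s' x by (intro mult_mono) auto
  then have "\<bar>T x - T y - s' * (x - y)\<bar> \<le> T_bound + slope_bound"
    using T_nonneg[of x] T_nonneg[of y] T_le[of x] T_le[of y] by linarith
  then have "lam ^ n * \<bar>T x - T y - s' * (x - y)\<bar> \<le> lam ^ n * (T_bound + slope_bound)" by simp
  moreover have "height s n k x - height s n k y = lam ^ n * (T x - T y - s' * (x - y))"
    using x by (simp add: d algebra_simps)
  ultimately show ?thesis by (simp add: abs_mult)
qed

text \<open>A strip whose thickness is comparable to the height \<open>lam ^ n / 2\<close> of the pieces meets only
  boundedly many times more pieces than a line, since each piece meeting the strip crosses one of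
  finitely many parallel lines with spacing \<open>lam ^ n / 2\<close>.\<close>

lemma card_near_strip:
  assumes s: "\<bar>s\<bar> \<le> slope_bound" and h: "h \<le> real K * (lam ^ n / 2)"
  shows "card (near s c h n) \<le> (2 * K + 2) * max_count n"
proof -
  define l where "l = lam ^ n / 2"
  have l: "l > 0" by (simp add: l_def)
  define I where "I = {- (int K + 1)..int K}"
  have "near s c h n \<subseteq> (\<Union>i\<in>I. near s (c + of_int i * l) 0 n)"
  proof
    fix k assume k: "k \<in> near s c h n"
    then obtain x where x: "x \<in> {0..1}" "\<bar>height s n k x - c\<bar> \<le> h" and k': "k < 2 ^ n"
      by (auto simp: near_def)
    obtain p where p: "p \<le> height s n k x" "height s n k x \<le> p + l"
      "{p..p + l} \<subseteq> height s n k ` {0..1}"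
      using height_window[OF k' x(1)] unfolding l_def by metis
    define i where "i = \<lceil>(p - c) / l\<rceil>"
    have "(p - c) / l \<le> of_int i" "of_int i < (p - c) / l + 1" unfolding i_def by linarith+
    then have "p - c \<le> of_int i * l" "of_int i * l < p - c + l" using l by (auto simp: field_simps)
    then have "c + of_int i * l \<in> {p..p + l}" by auto
    then have mem: "k \<in> near s (c + of_int i * l) 0 n" using p(3) k' unfolding near_def by force
    have "- (real K + 1) \<le> (p - c) / l" "(p - c) / l \<le> real K"
      using p x h l by (auto simp: field_simps l_def[symmetric])
    then have "i \<in> I" unfolding i_def I_def by (simp add: ceiling_le_iff le_ceiling_iff)
    then show "k \<in> (\<Union>i\<in>I. near s (c + of_int i * l) 0 n)" using mem by blast
  qed
  then have "card (near s c h n) \<le> card (\<Union>i\<in>I. near s (c + of_int i * l) 0 n)"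
    by (intro card_mono) (auto simp: I_def)
  also have "\<dots> \<le> (\<Sum>i\<in>I. card (near s (c + of_int i * l) 0 n))"
    by (rule card_UN_le) (simp add: I_def)
  also have "\<dots> \<le> (\<Sum>i\<in>I. max_count n)" by (intro sum_mono card_near_le_max_count s)
  also have "\<dots> = (2 * K + 2) * max_count n" by (simp add: I_def nat_add_distrib nat_mult_distrib)
  finally show ?thesis .
qed

text \<open>The total height of the pieces of level \<open>n\<close> is about \<open>2 ^ n * lam ^ n\<close>, so some horizontal
  line meets about that many of them.\<close>

lemma max_count_lower: "(2 * lam) ^ n \<le> (4 * T_bound + 4) * max_count n"
proof -
  define K where "K = nat \<lceil>2 * T_bound / lam ^ n\<rceil>"
  have K: "2 * T_bound / lam ^ n \<le> real K" "real K \<le> 2 * T_bound / lam ^ n + 1"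
    using T_bound_ge by (auto simp: K_def)
  have "near 0 0 T_bound n = {..<2 ^ n}"
    using T_nonneg T_le by (auto simp: near_def height_def intro!: bexI[of _ 0])
  moreover have "card (near 0 0 T_bound n) \<le> (2 * K + 2) * max_count n"
    using K slope_bound_ge by (intro card_near_strip) (auto simp: field_simps)
  ultimately have "2 ^ n \<le> (2 * K + 2) * max_count n" by simp
  then have "real (2 ^ n) \<le> real ((2 * K + 2) * max_count n)" by (rule of_nat_mono)
  then have "2 ^ n \<le> (2 * real K + 2) * max_count n" by (simp add: algebra_simps)
  also have "\<dots> \<le> (2 * (2 * T_bound / lam ^ n + 1) + 2) * max_count n"
    using K by (intro mult_right_mono) auto
  also have "\<dots> \<le> (2 * (2 * T_bound / lam ^ n + 1 / lam ^ n) + 2 * (1 / lam ^ n)) * max_count n"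
  proof -
    have "1 \<le> 1 / lam ^ n" using lam_lt by (simp add: power_le_one)
    moreover have "2 * (v + 1) + 2 \<le> 2 * (v + u) + 2 * u" if "1 \<le> u" for u v :: real using that by simp
    ultimately show ?thesis by (intro mult_right_mono of_nat_0_le_iff)
  qed
  also have "\<dots> = (4 * T_bound + 4) * max_count n / lam ^ n" by (simp add: field_simps)
  finally show ?thesis by (simp add: field_simps power_mult_distrib)
qed

text \<open>A line that meets all pieces of a fine level would be uniformly close to the graph, which is
  impossible because of the second difference of the graph at \<open>0\<close>, \<open>1 / 2\<close> and \<open>1\<close>.\<close>

lemma max_count_less: "\<exists>n>0. max_count n < 2 ^ n"
proof -
  have "(\<lambda>n. lam ^ n) \<longlonglongrightarrow> 0" using lam_lt by (intro LIMSEQ_realpow_zero) auto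
  then have "\<forall>\<^sub>F n in sequentially. lam ^ n < 1 / (4 * (T_bound + slope_bound))"
    using T_bound_ge slope_bound_ge by (intro order_tendstoD(2)) auto
  moreover have "\<forall>\<^sub>F n in sequentially. n > (0::nat)" by (rule eventually_gt_at_top)
  ultimately have "\<forall>\<^sub>F n in sequentially. lam ^ n < 1 / (4 * (T_bound + slope_bound)) \<and> n > 0"
    by (rule eventually_conj)
  then obtain n where n: "lam ^ n < 1 / (4 * (T_bound + slope_bound))" "n > 0"
    by (auto simp: eventually_sequentially)
  have small: "lam ^ n * (T_bound + slope_bound) < 1 / 4"
    using n T_bound_ge slope_bound_ge by (simp add: field_simps)
  have "max_count n \<noteq> 2 ^ n"
  proof
    assume eq: "max_count n = 2 ^ n"
    obtain s c where s: "\<bar>s\<bar> \<le> slope_bound" and c: "card (near s c 0 n) = 2 ^ n"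
      using max_count_attained eq by metis
    have "near s c 0 n = {..<2 ^ n}"
      using c by (intro card_subset_eq) (auto simp: near_def)
    have close: "\<bar>height s n k x - c\<bar> < 1 / 4" if "k < 2 ^ n" "x \<in> {0..1}" for k x
    proof -
      have "k \<in> near s c 0 n" using that \<open>near s c 0 n = _\<close> by simp
      then obtain y where "y \<in> {0..1}" "height s n k y = c" by (auto simp: near_def)
      then show ?thesis using height_variation[OF that(1) s that(2)] small by fastforce
    qed
    have "\<bar>T 0 - s * 0 - c\<bar> < 1 / 4" using close[of 0 0] by (simp add: height_def)
    moreover have "\<bar>T 1 - s * 1 - c\<bar> < 1 / 4"
      using close[of "2 ^ n - 1" 1] by (simp add: height_def of_nat_diff)
    moreover have "\<bar>T (1 / 2) - s * (1 / 2) - c\<bar> < 1 / 4"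
    proof -
      obtain n' where n': "n = Suc n'" using n(2) by (cases n) auto
      show ?thesis using close[of "2 ^ n'" 0] by (simp add: height_def n')
    qed
    ultimately show False using T_0 T_1 T_half by linarith
  qed
  then show ?thesis using max_count_le[of n] n by (intro exI[of _ n]) auto
qed

section \<open>The growth exponent\<close>

text \<open>By submultiplicativity the infimum is also the limit of the sequence (Fekete's lemma), so this is
  the exponential growth rate of \<open>max_count\<close>.\<close>

definition growth :: real where
  "growth = (INF n\<in>{1..}. log 2 (max_count n) / real n)"

lemma log_max_count_nonneg: "0 \<le> log 2 (real (max_count n)) / real n"
  using max_count_pos[of n] by (simp add: Suc_le_eq)

lemma growth_le: "0 < n \<Longrightarrow> growth \<le> log 2 (max_count n) / real n"
  unfolding growth_def
  by (intro cINF_lower bdd_belowI2[where m = 0]) (auto simp: log_max_count_nonneg)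

lemma powr_growth_le: "2 powr (growth * real n) \<le> max_count n"
proof (cases "n = 0")
  case True
  then show ?thesis using max_count_pos[of 0] by simp
next
  case False
  then have "growth * real n \<le> log 2 (max_count n)" using growth_le[of n] by (simp add: field_simps)
  then show ?thesis using max_count_pos[of n] by (simp add: le_log_iff)
qed

lemma max_count_upper:
  assumes "growth < t"
  shows "\<exists>C>0. \<forall>n. real (max_count n) \<le> C * 2 powr (t * real n)"
proof -
  have "\<exists>n\<in>{1..}. log 2 (max_count n) / real n < t"
    using assms unfolding growth_def
    by (subst (asm) cINF_less_iff) (auto intro!: bdd_belowI2[where m = 0] simp: log_max_count_nonneg)
  then obtain m where m: "m > 0" "log 2 (max_count m) / real m < t"
    by (auto simp: Suc_le_eq)
  then have "log 2 (max_count m) < t * real m" by (simp add: field_simps)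
  then have step: "max_count m < 2 powr (t * real m)" using max_count_pos[of m] by (simp add: log_less_iff)
  have t: "t \<ge> 0" using m(2) log_max_count_nonneg[of m] by linarith
  have "real (max_count n) \<le> 2 ^ m * 2 powr (t * real n)" for n
  proof (induction n rule: less_induct)
    case (less n)
    show ?case
    proof (cases "n < m")
      case True
      have "real (max_count n) \<le> 2 ^ n" using max_count_le[of n]
        by (metis of_nat_le_iff of_nat_numeral of_nat_power)
      also have "\<dots> \<le> 2 ^ m" using True by simp
      also have "\<dots> \<le> 2 ^ m * 2 powr (t * real n)" using t by (simp add: ge_one_powr_ge_zero)
      finally show ?thesis .
    next
      case False
      have "real (max_count n) \<le> real (max_count m) * real (max_count (n - m))"
        using max_count_submultiplicative[of m "n - m"] False
        by (metis le_add_diff_inverse not_less of_nat_le_iff of_nat_mult)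
      also have "\<dots> \<le> 2 powr (t * real m) * (2 ^ m * 2 powr (t * real (n - m)))"
        using step less.IH[of "n - m"] False m by (intro mult_mono) auto
      also have "\<dots> = 2 ^ m * 2 powr (t * real n)"
        using False by (simp add: powr_add[symmetric] of_nat_diff algebra_simps)
      finally show ?thesis .
    qed
  qed
  then show ?thesis by (intro exI[of _ "2 ^ m"]) auto
qed

text \<open>In other words, \<open>1 + growth\<close> is at least the box-counting dimension \<open>2 + log 2 lam\<close> of the graph.
  In the upper bound for the Assouad dimension this controls the scales at which entire pieces have
  to be covered, and not only their intersections with a strip.\<close>

lemma two_lam_le: "2 * lam \<le> 2 powr growth"
proof -
  have le: "2 * lam \<le> 2 powr t" if t: "growth < t" for t
  proof -
    obtain C where C: "C > 0" "\<And>n. real (max_count n) \<le> C * 2 powr (t * real n)"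
      using max_count_upper[OF t] by blast
    have "(2 * lam) ^ n \<le> ((4 * T_bound + 4) * C) * (2 powr t) ^ n" for n
    proof -
      have "(4 * T_bound + 4) * max_count n \<le> (4 * T_bound + 4) * (C * 2 powr (t * real n))"
        using T_bound_ge C by (intro mult_left_mono) auto
      then show ?thesis using max_count_lower[of n] by (simp add: powr_mult_nat mult.assoc)
    qed
    from le_of_power_bounded[OF _ this] show ?thesis by simp
  qed
  have "log 2 (2 * lam) \<le> growth"
    proof (rule dense_ge)
    fix t assume "growth < t"
    then show "log 2 (2 * lam) \<le> t" using le[of t] by (simp add: log_le_iff)
  qed
  then show ?thesis by (simp add: log_le_iff)
qed

lemma growth_pos: "0 < growth"
proof -
  have "2 powr 0 < 2 powr growth" using two_lam_le lam_gt by simp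
  then show ?thesis by (simp only: powr_less_cancel_iff)
qed

lemma growth_less_1: "growth < 1"
proof -
  obtain n where n: "n > 0" "max_count n < 2 ^ n" using max_count_less by blast
  then have "real (max_count n) < 2 ^ n" by (metis of_nat_less_iff of_nat_numeral of_nat_power)
  then have "log 2 (max_count n) < log 2 (2 ^ n)" using max_count_pos[of n] by (subst log_less_cancel_iff) auto
  then have "log 2 (max_count n) / real n < 1" using n by (simp add: field_simps log_nat_power)
  then show ?thesis using growth_le[OF n(1)] by simp
qed

end

section \<open>Lines\<close>

definition line :: "real \<Rightarrow> real \<Rightarrow> (real \<times> real) set" where
  "line s c = {(x, s * x + c) | x. True}"

lemma span_pair: "span {(a, b)} = {(t * a, t * b) | t. True}" for a b :: real
  by (auto simp: span_singleton)

lemma RP1_iff: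
  "V \<in> RP1 \<longleftrightarrow> V = {(0, t) | t. True} \<or> (\<exists>s. V = line s 0)"
proof
  assume V: "V \<in> RP1"
  then have V1: "subspace V" "dim V = 1" by (auto simp: RP1_def)
  obtain B where B: "B \<subseteq> V" "independent B" "V \<subseteq> span B" "card B = dim V"
    by (rule basis_exists[of V])
  from B(4) V1(2) obtain p where "B = {p}" by (metis card_1_singletonE)
  then obtain a b where ab: "B = {(a, b)}" by (cases p) auto
  have "span B \<subseteq> V" using B(1) V1(1) by (rule span_minimal)
  with B(3) have "V = span B" by (rule antisym)
  then have V': "V = {(t * a, t * b) | t. True}" unfolding ab span_pair .
  have "(a, b) \<noteq> 0" using B(2) ab dependent_zero[of B] by auto
  then have nz: "a \<noteq> 0 \<or> b \<noteq> 0" by (auto simp: zero_prod_def)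
  show "V = {(0, t) | t. True} \<or> (\<exists>s. V = line s 0)"
  proof (cases "a = 0")
    case True
    have "\<exists>t'. t = t' * b" for t using nz True by (intro exI[of _ "t / b"]) auto
    then show ?thesis unfolding V' True by auto
  next
    case False
    have "\<exists>t. x = t * a \<and> b / a * x = t * b" for x using False by (intro exI[of _ "x / a"]) auto
    then have "V = line (b / a) 0" unfolding V' line_def using False by auto
    then show ?thesis by blast
  qed
next
  have "{(0, t) | t. True} = span {(0::real, 1::real)}" unfolding span_pair by auto
  moreover have "line s 0 = span {(1, s)}" for s unfolding span_pair line_def by (auto simp: mult.commute)
  ultimately show "V \<in> RP1" if "V = {(0, t) | t. True} \<or> (\<exists>s. V = line s 0)"
    using that by (auto simp: RP1_def zero_prod_def)
qed

lemma line_translate: "(\<lambda>v. v + (a, b)) ` line s 0 = line s (b - s * a)"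
proof (rule set_eqI)
  fix p :: "real \<times> real"
  have "p \<in> (\<lambda>v. v + (a, b)) ` line s 0 \<longleftrightarrow> p - (a, b) \<in> line s 0"
    by (auto simp: image_iff intro: bexI[of _ "p - (a, b)"])
  also have "\<dots> \<longleftrightarrow> p \<in> line s (b - s * a)"
    by (cases p) (auto simp: line_def algebra_simps intro: exI[of _ "fst p - a"])
  finally show "p \<in> (\<lambda>v. v + (a, b)) ` line s 0 \<longleftrightarrow> p \<in> line s (b - s * a)" .
qed

section \<open>Hausdorff dimension from above\<close>

lemma hausdorff_measure_eq_0:
  assumes "\<And>\<eta>. \<eta> > 0 \<Longrightarrow> \<exists>I U. finite I \<and> E \<subseteq> (\<Union>i\<in>I. U i) \<and>
    (\<forall>i\<in>I. bounded (U i) \<and> diameter (U i) \<le> \<eta>) \<and> (\<Sum>i\<in>(I::nat set). diameter (U i) powr s) \<le> \<eta>"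
  shows "hausdorff_measure s E = 0"
proof -
  have "hausdorff_premeasure s \<delta> E \<le> ennreal e" if "\<delta> > 0" "e > 0" for \<delta> e :: real
  proof -
    have "0 < min \<delta> e" using that by simp
    from assms[OF this] obtain I :: "nat set" and U where I: "finite I" "E \<subseteq> (\<Union>i\<in>I. U i)"
      "\<forall>i\<in>I. bounded (U i) \<and> diameter (U i) \<le> min \<delta> e"
      "(\<Sum>i\<in>I. diameter (U i) powr s) \<le> min \<delta> e" by blast
    define U' where "U' i = (if i \<in> I then U i else {})" for i
    have "hausdorff_premeasure s \<delta> E \<le> (\<Sum>i. ennreal (diameter (U' i) powr s))"
      unfolding hausdorff_premeasure_def
    proof (rule Inf_lower, rule CollectI, intro exI conjI allI)
      show "E \<subseteq> (\<Union>i. U' i)" using I(2) by (auto simp: U'_def split: if_splits)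
    next
      fix i
      show "bounded (U' i)" "diameter (U' i) \<le> \<delta>" using I(3) that by (auto simp: U'_def)
    qed simp
    also have "\<dots> = (\<Sum>i\<in>I. ennreal (diameter (U' i) powr s))"
      by (rule suminf_finite[OF I(1)]) (simp add: U'_def)
    also have "\<dots> = ennreal (\<Sum>i\<in>I. diameter (U i) powr s)"
      by (simp add: U'_def sum_ennreal)
    also have "\<dots> \<le> ennreal e" using I(4) by (intro ennreal_leI) simp
    finally show ?thesis .
  qed
  then have "hausdorff_premeasure s \<delta> E = 0" if "\<delta> > 0" for \<delta>
    using that by (metis ennreal_le_epsilon add_0 bot.extremum_uniqueI bot_ennreal)
  then show ?thesis unfolding hausdorff_measure_def by (auto simp: SUP_eq_const)
qed

lemma hausdorff_dim_le:
  assumes "\<And>s. t < s \<Longrightarrow> hausdorff_measure s E = 0" "0 \<le> t"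
  shows "hausdorff_dim E \<le> ereal t"
proof (rule ereal_le_epsilon2)
  fix e :: real assume "0 < e"
  then show "hausdorff_dim E \<le> ereal t + ereal e"
    unfolding hausdorff_dim_def using assms by (intro Inf_lower) (auto intro!: exI[of _ "t + e"])
qed

lemma hausdorff_dim_subsingleton:
  assumes "E \<subseteq> {p}" shows "hausdorff_dim E \<le> 0"
proof -
  have "hausdorff_dim E \<le> ereal 0"
  proof (rule hausdorff_dim_le)
    fix s :: real assume "0 < s"
    show "hausdorff_measure s E = 0"
    proof (rule hausdorff_measure_eq_0)
      fix \<eta> :: real assume "\<eta> > 0"
      then show "\<exists>I U. finite I \<and> E \<subseteq> (\<Union>i\<in>I. U i) \<and>
        (\<forall>i\<in>I. bounded (U i) \<and> diameter (U i) \<le> \<eta>) \<and> (\<Sum>i\<in>(I::nat set). diameter (U i) powr s) \<le> \<eta>"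
        using assms by (intro exI[of _ "{0}"] exI[of _ "\<lambda>_. {p}"]) auto
    qed
  qed simp
  then show ?thesis by (simp add: zero_ereal_def)
qed

context takagi_parameter begin

lemma near_shift:
  assumes "h + \<bar>s - s'\<bar> + \<bar>c - c'\<bar> \<le> h'"
  shows "near s c h n \<subseteq> near s' c' h' n"
proof
  fix k assume "k \<in> near s c h n"
  then obtain x where k: "k < 2 ^ n" and x: "x \<in> {0..1}" and h: "\<bar>height s n k x - c\<bar> \<le> h"
    by (auto simp: near_def)
  define y where "y = (real k + x) / 2 ^ n"
  have y: "0 \<le> y" "y \<le> 1" using dyadic_point[OF k x] by (auto simp: y_def)
  have "height s' n k x - c' = (height s n k x - c) + (s - s') * y + (c - c')"
    unfolding height_def y_def[symmetric] by (simp add: left_diff_distrib)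
  then have "\<bar>height s' n k x - c'\<bar> \<le> \<bar>height s n k x - c\<bar> + \<bar>(s - s') * y\<bar> + \<bar>c - c'\<bar>"
    by linarith
  also have "\<bar>(s - s') * y\<bar> \<le> \<bar>s - s'\<bar>" unfolding abs_mult using y by (simp add: mult_left_le)
  also note h
  finally have "\<bar>height s' n k x - c'\<bar> \<le> h'" using assms by simp
  then show "k \<in> near s' c' h' n" using k x by (auto simp: near_def)
qed

text \<open>Renormalising an arbitrary line by a piece of a high level yields a line whose slope is
  almost in the attractor.  Hence from some level on the number of pieces grows no faster than for
  lines with slope in the attractor, up to the factor lost in the passage from lines to strips.\<close>

lemma near_count_any_slope:
  assumes "growth < t"
  shows "\<exists>C n m. n > 0 \<and> (\<forall>q. real (card (near s c 0 (m + n * q))) \<le> C * 2 powr (t * real (m + n * q)))"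
proof -
  obtain t' where t': "growth < t'" "t' < t" using dense assms by blast
  obtain C where C: "C > 0" "\<And>n. real (max_count n) \<le> C * 2 powr (t' * real n)"
    using max_count_upper[OF t'(1)] by blast
  have "1 < 2 powr (t - t')" using t' by simp
  then obtain n0 where n0: "4 * C + 1 < (2 powr (t - t')) ^ n0" using real_arch_pow by blast
  (* The factor 4 comes from passing to strips; n is so large that the gap between t' and t absorbs
     this factor and the constant C. *)
  define n where "n = Suc n0"
  have "4 * C < (2 powr (t - t')) ^ n"
    using n0 \<open>1 < 2 powr (t - t')\<close> power_increasing[of n0 n "2 powr (t - t')"] unfolding n_def by linarith
  then have "4 * C < 2 powr ((t - t') * real n)" by (simp add: powr_mult_nat)
  then have "4 * C * 2 powr (t' * real n) \<le> 2 powr ((t - t') * real n) * 2 powr (t' * real n)"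
    by (intro mult_right_mono) auto
  also have "\<dots> = 2 powr (t * real n)" by (simp add: powr_add[symmetric] algebra_simps)
  finally have n: "real (4 * max_count n) \<le> 2 powr (t * real n)" using C(2)[of n] by simp
  (* From level m0 on, the renormalised slope is within lam ^ n / 2 of the attractor. *)
  obtain m0 where m0: "2 * \<bar>s\<bar> / lam ^ n < (2 * lam) ^ m0"
    using real_arch_pow[of "2 * lam"] lam_gt by auto
  have step: "card (near s c 0 (m + n)) \<le> card (near s c 0 m) * (4 * max_count n)" if "m0 \<le> m" for m
  proof (rule card_near_split)
    fix i assume "i \<in> near s c 0 m"
    then have i: "i < 2 ^ m" by (simp add: near_def)
    obtain a where a: "\<bar>a\<bar> \<le> slope_bound * (1 - 1 / (2 * lam) ^ m)"
      "\<forall>s c. \<exists>c'. \<forall>h n. card {k \<in> near s c h (m + n). k div 2 ^ n = i}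
       \<le> card (near (s / (2 * lam) ^ m - a) c' (h / lam ^ m) n)"
      using near_descendants[OF i] by (elim exE conjE) (rule that)
    have a': "\<bar>- a\<bar> \<le> slope_bound"
      using slope_renormalised_bounded[OF a(1), of 0] slope_bound_ge by simp
    obtain c' where "card {k \<in> near s c 0 (m + n). k div 2 ^ n = i}
       \<le> card (near (s / (2 * lam) ^ m - a) c' (0 / lam ^ m) n)" using a(2) by meson
    also have "\<dots> \<le> card (near (- a) c' (lam ^ n / 2) n)"
    proof (rule card_mono[OF finite_near], rule near_shift)
      have "2 * \<bar>s\<bar> / lam ^ n < (2 * lam) ^ m"
        using m0 power_increasing[OF that, of "2 * lam"] lam_gt by linarith
      then have "2 * \<bar>s\<bar> < (2 * lam) ^ m * lam ^ n" by (simp add: pos_divide_less_eq)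
      then have "\<bar>s\<bar> / (2 * lam) ^ m \<le> lam ^ n / 2"
        by (simp add: pos_divide_le_eq mult.commute)
      then show "0 / lam ^ m + \<bar>s / (2 * lam) ^ m - a - - a\<bar> + \<bar>c' - c'\<bar> \<le> lam ^ n / 2"
        by (simp add: abs_mult power_abs)
    qed
    also have "\<dots> \<le> (2 * 1 + 2) * max_count n" by (rule card_near_strip[OF a']) simp
    finally show "card {k \<in> near s c 0 (m + n). k div 2 ^ n = i} \<le> 4 * max_count n" by simp
  qed
  define A where "A = 2 ^ m0 * 2 powr (- t * real m0)"
  have "real (card (near s c 0 (m0 + n * q))) \<le> A * 2 powr (t * real (m0 + n * q))" for q
  proof (induction q)
    case 0
    have "real (card (near s c 0 m0)) \<le> 2 ^ m0"
      using card_near_le[of s c 0 m0] by (metis of_nat_le_iff of_nat_numeral of_nat_power)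
    also have "\<dots> = A * 2 powr (t * real m0)" by (simp add: A_def powr_minus)
    finally show ?case by simp
  next
    case (Suc q)
    have "real (card (near s c 0 (m0 + n * Suc q))) = card (near s c 0 (m0 + n * q + n))"
      by (simp add: ac_simps)
    also have "\<dots> \<le> real (card (near s c 0 (m0 + n * q))) * real (4 * max_count n)"
      using step[of "m0 + n * q"] by (metis le_add1 of_nat_le_iff of_nat_mult)
    also have "\<dots> \<le> (A * 2 powr (t * real (m0 + n * q))) * 2 powr (t * real n)"
      by (intro mult_mono Suc.IH n) (auto simp: A_def)
    also have "\<dots> = A * 2 powr (t * real (m0 + n * Suc q))"
      by (simp add: mult.assoc powr_add[symmetric] distrib_left) (simp add: algebra_simps)
    finally show ?case .
  qed
  then show ?thesis by (intro exI[of _ A] exI[of _ n] exI[of _ m0]) (auto simp: n_def)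
qed

lemma graph_Int_line:
  "takagi_graph lam \<inter> line s c = {(y, s * y + c) | y. y \<in> {0..1} \<and> T y = s * y + c}"
  by (auto simp: takagi_graph_def line_def)

text \<open>The pieces meeting the line, at the levels given by \<open>near_count_any_slope\<close>, are efficient covers.\<close>

lemma hausdorff_dim_line_le: "hausdorff_dim (takagi_graph lam \<inter> line s c) \<le> ereal growth"
proof (rule hausdorff_dim_le)
  fix u assume u: "growth < u"
  then obtain t where t: "growth < t" "t < u" using dense by blast
  obtain C n m where n: "n > 0"
    and C: "\<And>q. real (card (near s c 0 (m + n * q))) \<le> C * 2 powr (t * real (m + n * q))"
    using near_count_any_slope[OF t(1), of s c] by blast
  define A where "A = 1 + \<bar>s\<bar>"
  define N where "N q = m + n * q" for q
  have N: "filterlim N at_top sequentially"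
    unfolding N_def using n by (intro filterlim_subseq) (auto simp: strict_mono_def)
  have "(\<lambda>k. (1 / 2) ^ k) \<longlonglongrightarrow> (0::real)" by (rule LIMSEQ_realpow_zero) auto
  from filterlim_compose[OF this N] have l1: "(\<lambda>q. A * (1 / 2) ^ N q) \<longlonglongrightarrow> 0"
    by (rule tendsto_mult_right_zero)
  have "(\<lambda>k. (2 powr (t - u)) ^ k) \<longlonglongrightarrow> (0::real)"
    using t powr_less_mono[of "t - u" 0 2] by (intro LIMSEQ_realpow_zero) auto
  from filterlim_compose[OF this N] have l2: "(\<lambda>q. C * A powr u * (2 powr (t - u)) ^ N q) \<longlonglongrightarrow> 0"
    by (rule tendsto_mult_right_zero)
  show "hausdorff_measure u (takagi_graph lam \<inter> line s c) = 0"
  proof (rule hausdorff_measure_eq_0)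
    fix \<eta> :: real assume \<eta>: "\<eta> > 0"
    have "\<forall>\<^sub>F q in sequentially. A * (1 / 2) ^ N q < \<eta> \<and> C * A powr u * (2 powr (t - u)) ^ N q < \<eta>"
      using order_tendstoD(2)[OF l1 \<eta>] order_tendstoD(2)[OF l2 \<eta>] by (rule eventually_conj)
    then obtain q where q: "A * (1 / 2) ^ N q < \<eta>" "C * A powr u * (2 powr (t - u)) ^ N q < \<eta>"
      by (auto simp: eventually_sequentially)
    define I where "I = near s c 0 (N q)"
    define U where "U k = (\<lambda>x. ((real k + x) / 2 ^ N q, s * ((real k + x) / 2 ^ N q) + c)) ` {0..1::real}" for k
    have cover: "takagi_graph lam \<inter> line s c \<subseteq> (\<Union>k\<in>I. U k)"
    proof
      fix p assume "p \<in> takagi_graph lam \<inter> line s c"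
      then obtain y where p: "p = (y, s * y + c)" and y: "y \<in> {0..1}" "T y = s * y + c"
        by (auto simp: graph_Int_line)
      obtain k x where kx: "k < 2 ^ N q" "x \<in> {0..1}" "y = (real k + x) / 2 ^ N q"
        using dyadic_index[OF y(1)] .
      have "\<bar>height s (N q) k x - c\<bar> \<le> 0" using y(2) unfolding height_def kx(3)[symmetric] by simp
      then have "k \<in> I" using kx by (auto simp: I_def near_def)
      moreover have "p \<in> U k" unfolding U_def p kx(3) using kx(2) by (rule imageI)
      ultimately show "p \<in> (\<Union>k\<in>I. U k)" by blast
    qed
    have dist: "dist a b \<le> A * (1 / 2) ^ N q" if "a \<in> U k" "b \<in> U k" for a b k
    proof -
      from that obtain x y where xy: "x \<in> {0..1}" "y \<in> {0..1}"
        "a = ((real k + x) / 2 ^ N q, s * ((real k + x) / 2 ^ N q) + c)"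
        "b = ((real k + y) / 2 ^ N q, s * ((real k + y) / 2 ^ N q) + c)" by (auto simp: U_def)
      have "dist a b \<le> dist (fst a) (fst b) + dist (snd a) (snd b)"
        unfolding dist_prod_def by (rule sqrt_sum_squares_le_sum) auto
      also have "\<dots> = \<bar>x - y\<bar> / 2 ^ N q + \<bar>s\<bar> * (\<bar>x - y\<bar> / 2 ^ N q)"
      proof -
        have "fst a - fst b = (x - y) / 2 ^ N q" by (simp add: xy diff_divide_distrib add_divide_distrib)
        moreover have "snd a - snd b = s * (fst a - fst b)" by (simp add: xy algebra_simps)
        ultimately show ?thesis by (simp add: dist_real_def abs_mult)
      qed
      also have "\<dots> = A * (\<bar>x - y\<bar> / 2 ^ N q)" by (simp only: A_def distrib_right mult_1)
      also have "\<dots> \<le> A * (1 / 2 ^ N q)"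
        using xy by (intro mult_left_mono divide_right_mono) (auto simp: A_def)
      finally show ?thesis by (simp add: power_divide)
    qed
    have bounded: "bounded (U k)" for k
      using dist unfolding bounded_two_points by blast
    have diam: "diameter (U k) \<le> A * (1 / 2) ^ N q" for k
      using dist by (intro diameter_le) (auto simp: A_def dist_norm)
    have "(\<Sum>k\<in>I. diameter (U k) powr u) \<le> (\<Sum>k\<in>I. (A * (1 / 2) ^ N q) powr u)"
      using u growth_pos diam by (intro sum_mono powr_mono2 diameter_ge_0 bounded) auto
    also have "\<dots> = real (card I) * (A * (1 / 2) ^ N q) powr u" by simp
    also have "\<dots> \<le> (C * 2 powr (t * real (N q))) * (A * (1 / 2) ^ N q) powr u"
      using C[of q] by (intro mult_right_mono) (auto simp: I_def N_def)
    also have "(A * (1 / 2) ^ N q) powr u = A powr u * 2 powr (- u * real (N q))"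
    proof -
      have "(1 / 2) ^ N q = (2::real) powr (- real (N q))" by (simp add: powr_minus powr_realpow power_divide field_simps)
      then show ?thesis by (simp add: powr_mult A_def powr_powr mult.commute)
    qed
    also have "(C * 2 powr (t * real (N q))) * (A powr u * 2 powr (- u * real (N q)))
        = C * A powr u * (2 powr (t - u)) ^ N q"
      by (simp add: powr_mult_nat[symmetric] mult_ac powr_add[symmetric]) (simp add: algebra_simps)
    finally have "(\<Sum>k\<in>I. diameter (U k) powr u) \<le> \<eta>" using q(2) by simp
    moreover have "diameter (U k) \<le> \<eta>" for k using diam[of k] q(1) by linarith
    ultimately show "\<exists>I U. finite I \<and> takagi_graph lam \<inter> line s c \<subseteq> (\<Union>i\<in>I. U i) \<and>
      (\<forall>i\<in>I. bounded (U i) \<and> diameter (U i) \<le> \<eta>) \<and> (\<Sum>i\<in>(I::nat set). diameter (U i) powr u) \<le> \<eta>"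
      using cover bounded by (intro exI[of _ I] exI[of _ U]) (auto simp: I_def)
  qed
qed (use growth_pos in simp)

section \<open>A line of maximal dimension\<close>

text \<open>A cut of a line is a family of dyadic pieces \<open>(m, j)\<close> such that every sufficiently small
  piece meeting the line descends from a member of the family.  In contrast to a cover of the
  intersection of the graph with the line, a cut remains a cut for all nearby lines.\<close>

definition dyadic_cut :: "(nat \<times> nat) set \<Rightarrow> real \<Rightarrow> real \<Rightarrow> bool" where
  "dyadic_cut W s c \<longleftrightarrow> finite W \<and>
     (\<exists>n. \<forall>k\<in>near s c 0 n. \<exists>(m, j)\<in>W. m \<le> n \<and> k div 2 ^ (n - m) = j)"

definition cut_sum :: "real \<Rightarrow> (nat \<times> nat) set \<Rightarrow> real" where
  "cut_sum t W = (\<Sum>(m, j)\<in>W. 2 powr (- t * real m))"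

text \<open>A piece that does not meet a line has positive vertical distance from it, by compactness.\<close>

lemma near_0_stable: "\<exists>e>0. near s c e n = near s c 0 n"
proof -
  have "\<exists>e>0. k \<notin> near s c e n" if k: "k \<notin> near s c 0 n" "k < 2 ^ n" for k
  proof -
    have pos: "0 < \<bar>height s n k x - c\<bar>" if "x \<in> {0..1}" for x
      using k that by (auto simp: near_def)
    have "continuous_on {0..1} (\<lambda>x. \<bar>height s n k x - c\<bar>)"
      by (intro continuous_intros continuous_on_height)
    then obtain x0 where x0: "x0 \<in> {0..1}"
      "\<And>x. x \<in> {0..1} \<Longrightarrow> \<bar>height s n k x0 - c\<bar> \<le> \<bar>height s n k x - c\<bar>"
      using continuous_attains_inf[of "{0..1::real}"] by force
    have "k \<notin> near s c (\<bar>height s n k x0 - c\<bar> / 2) n"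
    proof
      assume "k \<in> near s c (\<bar>height s n k x0 - c\<bar> / 2) n"
      then obtain x where x: "x \<in> {0..1}" "\<bar>height s n k x - c\<bar> \<le> \<bar>height s n k x0 - c\<bar> / 2"
        by (auto simp: near_def)
      from order_trans[OF x0(2)[OF x(1)] x(2)] show False using pos[OF x0(1)] by simp
    qed
    then show ?thesis using pos[OF x0(1)] by (intro exI[of _ "\<bar>height s n k x0 - c\<bar> / 2"]) simp
  qed
  then obtain e where e: "\<And>k. k \<notin> near s c 0 n \<Longrightarrow> k < 2 ^ n \<Longrightarrow> e k > 0 \<and> k \<notin> near s c (e k) n"
    by metis
  define A where "A = insert 1 (e ` ({..<2 ^ n} - near s c 0 n))"
  have fin: "finite A" "A \<noteq> {}" by (auto simp: A_def)
  have pos: "0 < Min A" using fin e by (auto simp: A_def)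
  have "near s c (Min A) n = near s c 0 n"
  proof
    show "near s c 0 n \<subseteq> near s c (Min A) n" by (rule near_shift) (use pos in simp)
    show "near s c (Min A) n \<subseteq> near s c 0 n"
    proof (rule subsetI, rule ccontr)
      fix k assume k: "k \<in> near s c (Min A) n" "k \<notin> near s c 0 n"
      then have k': "k < 2 ^ n" by (simp add: near_def)
      have "Min A \<le> e k" using k k' fin(1) by (intro Min_le) (auto simp: A_def)
      then have "near s c (Min A) n \<subseteq> near s c (e k) n" by (intro near_shift) simp
      then show False using k e[OF k(2) k'] by blast
    qed
  qed
  then show ?thesis using pos by blast
qed

lemma near_empty_if_far:
  assumes "\<bar>s\<bar> \<le> slope_bound" "T_bound + slope_bound < \<bar>c\<bar>"
  shows "near s c 0 n = {}"
proof -
  have "height s n k x \<noteq> c" if "k < 2 ^ n" "x \<in> {0..1}" for k x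
  proof -
    define y where "y = (real k + x) / 2 ^ n"
    have y: "0 \<le> y" "y \<le> 1" using dyadic_point[OF that] by (auto simp: y_def)
    have "\<bar>s * y\<bar> \<le> slope_bound * 1" unfolding abs_mult using assms y by (intro mult_mono) auto
    then have "\<bar>T y - s * y\<bar> \<le> T_bound + slope_bound"
      using T_nonneg[of y] T_le[of y] by linarith
    then show ?thesis using assms by (auto simp: height_def y_def)
  qed
  then show ?thesis by (auto simp: near_def)
qed

text \<open>If every line had a cut whose sum with exponent \<open>growth\<close> is less than one, then by
  compactness finitely many such cuts would serve all lines, with a common exponent \<open>t < growth\<close>.
  Counting pieces recursively through these cuts would then bound their number by a multiple of
  \<open>2 powr (t * n)\<close>, contradicting the choice of the growth exponent.\<close>

lemma exists_critical_line:
  "\<exists>s c. \<bar>s\<bar> \<le> slope_bound \<and> (\<forall>W. dyadic_cut W s c \<longrightarrow> 1 \<le> cut_sum growth W)"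
proof (rule ccontr)
  assume "\<not> ?thesis"
  then have neg: "\<exists>W. dyadic_cut W s c \<and> cut_sum growth W < 1" if "\<bar>s\<bar> \<le> slope_bound" for s c
    using that by (meson not_le)
  define R where "R s c W t n e \<longleftrightarrow> finite W \<and> 0 < t \<and> t < growth \<and> cut_sum t W < 1 \<and> 0 < e \<and>
     (\<forall>s' c'. \<bar>s - s'\<bar> + \<bar>c - c'\<bar> \<le> e \<longrightarrow>
        (\<forall>k\<in>near s' c' 0 n. \<exists>(m, j)\<in>W. m \<le> n \<and> k div 2 ^ (n - m) = j))" for s c W t n e
  have "\<exists>W t n e. R s c W t n e"
    if s: "\<bar>s\<bar> \<le> slope_bound" for s c
  proof -
    obtain W n where W: "finite W" "cut_sum growth W < 1"
      and n: "\<forall>k\<in>near s c 0 n. \<exists>(m, j)\<in>W. m \<le> n \<and> k div 2 ^ (n - m) = j"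
      using neg[OF s, of c] by (auto simp: dyadic_cut_def)
    have "isCont (\<lambda>t. cut_sum t W) growth"
      unfolding cut_sum_def case_prod_unfold by (intro continuous_intros) auto
    then have "((\<lambda>t. cut_sum t W) \<longlongrightarrow> cut_sum growth W) (at_left growth)"
      by (simp add: isCont_def filterlim_at_split)
    then have "\<forall>\<^sub>F t in at_left growth. cut_sum t W < 1"
      using W(2) by (rule order_tendstoD)
    moreover have "\<forall>\<^sub>F t in at_left growth. t \<in> {0<..<growth}"
      using growth_pos by (rule eventually_at_left_real)
    ultimately have "\<forall>\<^sub>F t in at_left growth. cut_sum t W < 1 \<and> t \<in> {0<..<growth}"
      by (rule eventually_conj)
    then obtain t where t: "cut_sum t W < 1" "0 < t" "t < growth"
      using eventually_happens[of _ "at_left growth"] by (auto simp: trivial_limit_at_left_real)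
    obtain e where e: "e > 0" "near s c e n = near s c 0 n" using near_0_stable by blast
    have "near s' c' 0 n \<subseteq> near s c 0 n" if "\<bar>s - s'\<bar> + \<bar>c - c'\<bar> \<le> e" for s' c'
      unfolding e(2)[symmetric] using that by (intro near_shift) (simp add: abs_minus_commute)
    then have "R s c W t n e" unfolding R_def using W(1) t e(1) n by blast
    then show ?thesis by blast
  qed
  then obtain W t n e where R: "\<And>s c. \<bar>s\<bar> \<le> slope_bound \<Longrightarrow> R s c (W s c) (t s c) (n s c) (e s c)"
    by metis
  have
    fin: "finite (W s c)" and
    t: "0 < t s c \<and> t s c < growth" and
    sum: "cut_sum (t s c) (W s c) < 1" and
    e: "0 < e s c" and
    cut: "\<And>s' c' k. \<bar>s - s'\<bar> + \<bar>c - c'\<bar> \<le> e s c \<Longrightarrow>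
       k \<in> near s' c' 0 (n s c) \<Longrightarrow> \<exists>(m, j)\<in>W s c. m \<le> n s c \<and> k div 2 ^ (n s c - m) = j"
    if "\<bar>s\<bar> \<le> slope_bound" for s c
    using R[OF that, of c] unfolding R_def by blast+
  define b where "b = T_bound + slope_bound"
  (* A line with slope in the attractor and intercept outside this range misses the graph. *)
  define K where "K = {-slope_bound..slope_bound} \<times> {-b..b}"
  have cK: "compact K" unfolding K_def by (intro compact_Times compact_Icc)
  have cov: "K \<subseteq> (\<Union>p\<in>K. ball p (e (fst p) (snd p) / 2))"
    using e by (force simp: K_def abs_le_iff)
  obtain P where P: "P \<subseteq> K" "finite P" "K \<subseteq> (\<Union>p\<in>P. ball p (e (fst p) (snd p) / 2))"
    by (rule compactE_image[OF cK _ cov]) auto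
  have PK: "\<bar>fst p\<bar> \<le> slope_bound" if "p \<in> P" for p using that P(1) by (auto simp: K_def abs_le_iff)
  have "(0, 0) \<in> K" using T_bound_ge slope_bound_ge by (auto simp: K_def b_def)
  then have ne: "P \<noteq> {}" using P(3) by auto
  define t0 where "t0 = Max ((\<lambda>p. t (fst p) (snd p)) ` P)"
  define n0 where "n0 = Max ((\<lambda>p. n (fst p) (snd p)) ` P)"
  have t0: "t (fst p) (snd p) \<le> t0" if "p \<in> P" for p unfolding t0_def using that P(2) by (intro Max_ge) auto
  have n0: "n (fst p) (snd p) \<le> n0" if "p \<in> P" for p unfolding n0_def using that P(2) by (intro Max_ge) auto
  have t0_less: "t0 < growth" unfolding t0_def using P(2) ne t PK by simp
  have t0_nonneg: "0 \<le> t0" using ne t PK t0 by (metis all_not_in_conv less_le_trans less_imp_le)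
  have bound: "real (max_count N) \<le> 2 ^ n0 * 2 powr (t0 * real N)" for N
  proof (induction N rule: less_induct)
    case (less N)
    show ?case
    proof (cases "N < n0")
      case True
      have "real (max_count N) \<le> 2 ^ N" using max_count_le[of N]
        by (metis of_nat_le_iff of_nat_numeral of_nat_power)
      also have "\<dots> \<le> 2 ^ n0" using True by simp
      also have "\<dots> \<le> 2 ^ n0 * 2 powr (t0 * real N)" using t0_nonneg by (simp add: ge_one_powr_ge_zero)
      finally show ?thesis .
    next
      case False
      obtain s c where s: "\<bar>s\<bar> \<le> slope_bound" and c: "card (near s c 0 N) = max_count N"
        by (rule max_count_attained)
      have "near s c 0 N \<noteq> {}" using c max_count_pos[of N] by auto
      then have "\<bar>c\<bar> \<le> b" using near_empty_if_far[OF s, of c N] unfolding b_def by (meson not_le)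
      then have "(s, c) \<in> K" using s by (auto simp: K_def abs_le_iff)
      then obtain p where p: "p \<in> P" "dist p (s, c) < e (fst p) (snd p) / 2" using P(3) by auto
      obtain s0 c0 where p_eq: "p = (s0, c0)" by (cases p)
      note s0 = PK[OF p(1), unfolded p_eq fst_conv]
      have "\<bar>s0 - s\<bar> \<le> dist p (s, c)" "\<bar>c0 - c\<bar> \<le> dist p (s, c)"
        using dist_fst_le[of p "(s, c)"] dist_snd_le[of p "(s, c)"] by (auto simp: p_eq dist_real_def)
      then have close: "\<bar>s0 - s\<bar> + \<bar>c0 - c\<bar> \<le> e s0 c0" using p(2) by (simp add: p_eq)
      define V where "V = {(m, j) \<in> W s0 c0. m \<le> n s0 c0}"
      have finV: "finite V" unfolding V_def by (rule finite_subset[OF _ fin[OF s0, of c0]]) auto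
      have n0': "n s0 c0 \<le> N" using n0[OF p(1)] False by (simp add: p_eq)
      have pos: "m > 0" if "(m, j) \<in> V" for m j
      proof (rule ccontr)
        assume "\<not> 0 < m"
        then have m0: "m = 0" by simp
        have "(\<Sum>(m, j)\<in>{(m, j)}. 2 powr (- t s0 c0 * real m)) \<le> cut_sum (t s0 c0) (W s0 c0)"
          unfolding cut_sum_def using that fin[OF s0, of c0] by (intro sum_mono2) (auto simp: V_def)
        then show False using sum[OF s0, of c0] by (simp add: m0)
      qed
      have "near s c 0 N \<subseteq> (\<Union>(m, j)\<in>V. {k \<in> near s c 0 N. k div 2 ^ (N - m) = j})"
      proof
        fix k assume k: "k \<in> near s c 0 N"
        then have "k div 2 ^ (N - n s0 c0) \<in> near s c 0 (n s0 c0)"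
          using near_ancestor[of k s c 0 "n s0 c0" "N - n s0 c0"] n0' by simp
        from cut[OF s0 close this] obtain m j where mj: "(m, j) \<in> W s0 c0" "m \<le> n s0 c0"
          "k div 2 ^ (N - n s0 c0) div 2 ^ (n s0 c0 - m) = j" by auto
        have "k div 2 ^ (N - m) = j"
          using mj(2,3) n0' by (simp add: div_mult2_eq[symmetric] power_add[symmetric])
        then show "k \<in> (\<Union>(m, j)\<in>V. {k \<in> near s c 0 N. k div 2 ^ (N - m) = j})"
          using k mj by (auto simp: V_def)
      qed
      then have "max_count N \<le> card (\<Union>(m, j)\<in>V. {k \<in> near s c 0 N. k div 2 ^ (N - m) = j})"
        unfolding c[symmetric] by (intro card_mono) (auto intro!: finite_UN_I finV)
      also have "\<dots> \<le> (\<Sum>(m, j)\<in>V. card {k \<in> near s c 0 N. k div 2 ^ (N - m) = j})"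
        using card_UN_le[OF finV] by (simp add: case_prod_unfold)
      also have "\<dots> \<le> (\<Sum>(m, j)\<in>V. max_count (N - m))"
      proof (intro sum_mono, clarify)
        fix m j assume "(m, j) \<in> V"
        then have "m + (N - m) = N" using n0' by (auto simp: V_def)
        then show "card {k \<in> near s c 0 N. k div 2 ^ (N - m) = j} \<le> max_count (N - m)"
          using card_descendants_le[OF s, of c m "N - m" j] by simp
      qed
      finally have "real (max_count N) \<le> (\<Sum>(m, j)\<in>V. real (max_count (N - m)))"
        by (simp add: case_prod_unfold flip: of_nat_sum)
      also have "\<dots> \<le> (\<Sum>(m, j)\<in>V. 2 ^ n0 * 2 powr (t0 * real N) * 2 powr (- t s0 c0 * real m))"
      proof (intro sum_mono, clarify)
        fix m j assume mj: "(m, j) \<in> V"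
        then have m: "0 < m" "m \<le> N" using pos n0' by (auto simp: V_def)
        have "real (max_count (N - m)) \<le> 2 ^ n0 * 2 powr (t0 * real (N - m))"
          using m by (intro less.IH) simp
        also have "\<dots> = 2 ^ n0 * 2 powr (t0 * real N) * 2 powr (- t0 * real m)"
          using m by (simp add: mult.assoc powr_add[symmetric] of_nat_diff right_diff_distrib)
        also have "\<dots> \<le> 2 ^ n0 * 2 powr (t0 * real N) * 2 powr (- t s0 c0 * real m)"
          using t0[OF p(1)] by (intro mult_left_mono powr_mono) (auto simp: p_eq mult_right_mono)
        finally show "real (max_count (N - m)) \<le> 2 ^ n0 * 2 powr (t0 * real N) * 2 powr (- t s0 c0 * real m)" .
      qed
      also have "\<dots> = 2 ^ n0 * 2 powr (t0 * real N) * (\<Sum>(m, j)\<in>V. 2 powr (- t s0 c0 * real m))"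
        by (simp add: sum_distrib_left case_prod_unfold)
      also have "\<dots> \<le> 2 ^ n0 * 2 powr (t0 * real N) * 1"
      proof (intro mult_left_mono)
        have "(\<Sum>(m, j)\<in>V. 2 powr (- t s0 c0 * real m)) \<le> cut_sum (t s0 c0) (W s0 c0)"
          unfolding cut_sum_def using fin[OF s0, of c0] by (intro sum_mono2) (auto simp: V_def)
        then show "(\<Sum>(m, j)\<in>V. 2 powr (- t s0 c0 * real m)) \<le> 1" using sum[OF s0, of c0] by linarith
      qed auto
      finally show ?thesis by simp
    qed
  qed
  have "(2 powr growth) ^ N \<le> 2 ^ n0 * (2 powr t0) ^ N" for N
    using powr_growth_le[of N] bound[of N] by (simp add: powr_mult_nat)
  from le_of_power_bounded[OF _ this] have "2 powr growth \<le> 2 powr t0" by simp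
  then show False using t0_less by simp
qed

end

section \<open>Hausdorff dimension from below\<close>

lemma hausdorff_measure_0_cover:
  assumes "hausdorff_measure s E = 0" "\<eta> > 0"
  obtains U :: "nat \<Rightarrow> 'a::metric_space set" where "E \<subseteq> (\<Union>i. U i)" "\<And>i. bounded (U i)" "\<And>i. diameter (U i) \<le> 1"
    "\<And>I. finite I \<Longrightarrow> (\<Sum>i\<in>I. diameter (U i) powr s) < \<eta>"
proof -
  have "hausdorff_premeasure s 1 E \<le> hausdorff_measure s E"
    unfolding hausdorff_measure_def by (rule SUP_upper) simp
  then have "hausdorff_premeasure s 1 E < ennreal \<eta>" using assms by simp
  then obtain U where U: "E \<subseteq> (\<Union>i. U i)" "\<forall>i. bounded (U i) \<and> diameter (U i) \<le> 1"
    "(\<Sum>i. ennreal (diameter (U i) powr s)) < ennreal \<eta>"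
    unfolding hausdorff_premeasure_def Inf_less_iff by blast
  have "(\<Sum>i\<in>I. diameter (U i) powr s) < \<eta>" if "finite I" for I
  proof -
    have "ennreal (\<Sum>i\<in>I. diameter (U i) powr s) = (\<Sum>i\<in>I. ennreal (diameter (U i) powr s))"
      by (simp add: sum_ennreal)
    also have "\<dots> \<le> (\<Sum>i. ennreal (diameter (U i) powr s))" using that by (intro sum_le_suminf) auto
    also note U(3)
    finally show ?thesis using assms(2) by (simp add: ennreal_less_iff sum_nonneg)
  qed
  then show ?thesis using U(2) by (intro that[OF U(1)]) auto
qed

context takagi_parameter begin

text \<open>Every cover of the intersection with a critical line by small sets yields a cut, on replacing
  the finitely many sets of a subcover by the dyadic pieces of comparable size that are close to them.\<close>

lemma hausdorff_dim_critical_line: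
  assumes crit: "\<And>W. dyadic_cut W s c \<Longrightarrow> 1 \<le> cut_sum growth W"
  shows "ereal growth \<le> hausdorff_dim (takagi_graph lam \<inter> line s c)"
  unfolding hausdorff_dim_def
proof (rule Inf_greatest, clarify)
  fix u assume u: "0 < u" "hausdorff_measure u (takagi_graph lam \<inter> line s c) = 0"
  show "ereal growth \<le> ereal u"
  proof (rule ccontr)
    assume "\<not> ereal growth \<le> ereal u"
    then have ug: "u < growth" by simp
    (* Small enough for the estimate at the end, which yields 1 \<le> 28 * \<eta>. *)
    define \<eta> :: real where "\<eta> = 1 / 30"
    obtain U where U: "takagi_graph lam \<inter> line s c \<subseteq> (\<Union>i. U i)" "\<And>i. bounded (U i)"
      "\<And>i::nat. diameter (U i) \<le> 1" "\<And>I. finite I \<Longrightarrow> (\<Sum>i\<in>I. diameter (U i) powr u) < \<eta>"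
      using hausdorff_measure_0_cover[OF u(2), of \<eta>] unfolding \<eta>_def by auto
    (* The diameters may vanish, but open neighbourhoods are needed for the compactness argument, so
       they are replaced by positive radii at the cost of another \<eta>. *)
    define r where "r i = max (diameter (U i)) ((\<eta> * (1 / 2) ^ Suc i) powr (1 / u))" for i
    define x where "x i = fst (SOME p. p \<in> U i)" for i
    have r: "0 < r i" "r i \<le> 1" for i
    proof -
      have "\<eta> * (1 / 2) ^ Suc i \<le> 1 * 1" unfolding \<eta>_def by (intro mult_mono power_le_one) auto
      then have "(\<eta> * (1 / 2) ^ Suc i) powr (1 / u) \<le> 1 powr (1 / u)"
        using u by (intro powr_mono2) (auto simp: \<eta>_def)
      then show "r i \<le> 1" using U(3) by (simp add: r_def)
      have "0 < (\<eta> * (1 / 2) ^ Suc i) powr (1 / u)" by (simp add: \<eta>_def)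
      then show "0 < r i" unfolding r_def by linarith
    qed
    obtain k where k: "\<And>i. r i * 2 ^ k i \<le> 1" "\<And>i. 1 < 2 * r i * 2 ^ k i"
      using exists_dyadic_scale[OF r] by metis
    define Y where "Y = {y \<in> {0..1}. T y - s * y - c = 0}"
    have cY: "compact Y"
    proof -
      have "closed Y" unfolding Y_def
        by (intro continuous_closed_preimage_constant continuous_intros continuous_on_T)
      moreover have "bounded Y" by (rule bounded_subset[OF bounded_closed_interval[of 0 1]]) (auto simp: Y_def)
      ultimately show ?thesis by (simp add: compact_eq_bounded_closed)
    qed
    have covY: "Y \<subseteq> (\<Union>i\<in>UNIV. ball (x i) (2 * r i))"
    proof
      fix y assume "y \<in> Y"
      then have "(y, s * y + c) \<in> takagi_graph lam \<inter> line s c" by (auto simp: Y_def graph_Int_line)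
      then obtain i where i: "(y, s * y + c) \<in> U i" using U(1) by blast
      define p where "p = (SOME p. p \<in> U i)"
      have "p \<in> U i" unfolding p_def using i by (rule someI)
      then have "dist p (y, s * y + c) \<le> diameter (U i)" using i U(2) by (intro diameter_bounded_bound)
      then have "dist (x i) y \<le> diameter (U i)"
        using dist_fst_le[of p "(y, s * y + c)"] by (simp add: x_def p_def)
      also have "\<dots> \<le> r i" by (simp add: r_def)
      finally show "y \<in> (\<Union>i\<in>UNIV. ball (x i) (2 * r i))" using r(1)[of i] by (auto intro!: exI[of _ i])
    qed
    obtain I where I: "finite I" "Y \<subseteq> (\<Union>i\<in>I. ball (x i) (2 * r i))"
      by (rule compactE_image[OF cY _ covY]) auto
    (* In units of 2 ^ - k i, the ball has radius at most 2 and each piece has width 1. *)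
    define J where "J i = {j. \<bar>real j - x i * 2 ^ k i\<bar> \<le> 3}" for i
    define W where "W = (\<Union>i\<in>I. {k i} \<times> J i)"
    have finJ: "finite (J i)" for i unfolding J_def by (rule card_nat_near_le)
    have cardJ: "real (card (J i)) \<le> 7" for i unfolding J_def using card_nat_near_le(2)[of 3] by simp
    have "dyadic_cut W s c"
      unfolding dyadic_cut_def
    proof (intro conjI exI ballI)
      show "finite W" unfolding W_def using I(1) finJ by auto
      define n where "n = sum k I"
      fix l assume "l \<in> near s c 0 n"
      then obtain z where z: "z \<in> {0..1}" and l: "l < 2 ^ n" and hz: "height s n l z = c"
        by (auto simp: near_def)
      define y where "y = (real l + z) / 2 ^ n"
      have "y \<in> Y" using dyadic_point[OF l z] hz by (auto simp: Y_def y_def height_def)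
      then obtain i where i: "i \<in> I" "dist (x i) y < 2 * r i" using I(2) by auto
      have le: "k i \<le> n" unfolding n_def using I(1) i(1) by (intro member_le_sum) auto
      define j where "j = l div 2 ^ (n - k i)"
      define w where "w = (real (l mod 2 ^ (n - k i)) + z) / 2 ^ (n - k i)"
      have w: "w \<in> {0..1}" unfolding w_def using z by (intro dyadic_point) auto
      have "y = (real j + w) / 2 ^ k i"
        using dyadic_child_point[of l z "k i" "n - k i"] le by (simp add: y_def j_def w_def)
      then have "y * 2 ^ k i = real j + w" by simp
      moreover have "\<bar>x i * 2 ^ k i - y * 2 ^ k i\<bar> \<le> 2"
      proof -
        have "\<bar>x i * 2 ^ k i - y * 2 ^ k i\<bar> = dist (x i) y * 2 ^ k i"
          by (simp add: dist_real_def abs_mult left_diff_distrib[symmetric])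
        also have "\<dots> \<le> 2 * r i * 2 ^ k i" using i(2) by (intro mult_right_mono) auto
        also have "\<dots> \<le> 2" using k(1)[of i] by simp
        finally show ?thesis .
      qed
      ultimately have "j \<in> J i" using w by (auto simp: J_def)
      then have "(k i, j) \<in> W" using i(1) by (auto simp: W_def)
      then show "\<exists>(m, j)\<in>W. m \<le> n \<and> l div 2 ^ (n - m) = j" using le by (auto simp: j_def)
    qed
    then have "1 \<le> cut_sum growth W" by (rule crit)
    also have "\<dots> \<le> (\<Sum>i\<in>I. \<Sum>(m, j)\<in>{k i} \<times> J i. 2 powr (- growth * real m))"
      unfolding cut_sum_def W_def using I(1) finJ by (intro sum_UN_le) auto
    also have "\<dots> = (\<Sum>i\<in>I. real (card (J i)) * 2 powr (- growth * real (k i)))"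
    proof (intro sum.cong refl)
      fix i
      have "(\<Sum>(m, j)\<in>{k i} \<times> J i. 2 powr (- growth * real m)) = (\<Sum>p\<in>{k i} \<times> J i. 2 powr (- growth * real (k i)))"
        by (intro sum.cong) auto
      also have "\<dots> = real (card (J i)) * 2 powr (- growth * real (k i))" by (simp add: card_cartesian_product)
      finally show "(\<Sum>(m, j)\<in>{k i} \<times> J i. 2 powr (- growth * real m))
         = real (card (J i)) * 2 powr (- growth * real (k i))" .
    qed
    also have "\<dots> \<le> (\<Sum>i\<in>I. 14 * (diameter (U i) powr u + \<eta> * (1 / 2) ^ Suc i))"
    proof (intro sum_mono)
      fix i
      have "1 / 2 ^ k i \<le> 2 * r i" using k(2)[of i] by (simp add: field_simps)
      have "2 powr (- growth * real (k i)) = (1 / 2 ^ k i) powr growth"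
        by (simp add: powr_divide powr_powr powr_minus field_simps flip: powr_realpow)
      also have "\<dots> \<le> (2 * r i) powr growth"
        using \<open>1 / 2 ^ k i \<le> 2 * r i\<close> growth_pos by (intro powr_mono2) auto
      also have "\<dots> = 2 powr growth * r i powr growth" using r(1)[of i] by (simp add: powr_mult)
      also have "\<dots> \<le> 2 powr 1 * r i powr u"
        using growth_less_1 ug r[of i] by (intro mult_mono powr_mono powr_mono') auto
      also have "r i powr u \<le> diameter (U i) powr u + \<eta> * (1 / 2) ^ Suc i"
      proof (cases "diameter (U i) \<le> (\<eta> * (1 / 2) ^ Suc i) powr (1 / u)")
        case True
        then have eq: "r i powr u = \<eta> * (1 / 2) ^ Suc i" using u by (simp add: r_def powr_powr \<eta>_def)
        show ?thesis unfolding eq by simp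
      next
        case False
        then have "r i powr u = diameter (U i) powr u" by (simp add: r_def)
        then show ?thesis by (simp add: \<eta>_def)
      qed
      finally have "2 powr (- growth * real (k i)) \<le> 2 * (diameter (U i) powr u + \<eta> * (1 / 2) ^ Suc i)"
        by simp
      then have "real (card (J i)) * 2 powr (- growth * real (k i))
         \<le> 7 * (2 * (diameter (U i) powr u + \<eta> * (1 / 2) ^ Suc i))"
        using cardJ[of i] by (intro mult_mono) auto
      then show "real (card (J i)) * 2 powr (- growth * real (k i))
         \<le> 14 * (diameter (U i) powr u + \<eta> * (1 / 2) ^ Suc i)" by simp
    qed
    also have "\<dots> = 14 * ((\<Sum>i\<in>I. diameter (U i) powr u) + \<eta> * (\<Sum>i\<in>I. (1 / 2) ^ Suc i))"
      by (simp add: sum_distrib_left sum.distrib)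
    also have "\<dots> \<le> 14 * (\<eta> + \<eta> * 1)"
    proof -
      have "(\<Sum>i\<in>I. (1 / 2) ^ Suc i) \<le> (\<Sum>i. (1 / 2) ^ Suc i :: real)"
        using I(1) power_half_series by (intro sum_le_suminf) (auto simp: sums_iff)
      then have "(\<Sum>i\<in>I. (1 / 2) ^ Suc i) \<le> (1::real)" using power_half_series by (simp add: sums_iff)
      then show ?thesis using U(4)[OF I(1)] by (intro mult_left_mono add_mono) (auto simp: \<eta>_def)
    qed
    finally show False by (simp add: \<eta>_def)
  qed
qed

end

section \<open>Assouad dimension from above\<close>

lemma covering_number_le:
  "finite F \<Longrightarrow> E \<subseteq> (\<Union>p\<in>F. cball p r) \<Longrightarrow> covering_number r E \<le> enat (card F)"
  unfolding covering_number_def by (rule Inf_lower) blast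

lemma cover_rectangle:
  fixes w h a b :: real
  assumes w: "0 < w" and h: "0 \<le> h"
  shows "\<exists>F. finite F \<and> real (card F) \<le> h / w + 1 \<and> {a..a + w} \<times> {b..b + h} \<subseteq> (\<Union>p\<in>F. cball p w)"
proof -
  define F where "F = (\<lambda>i::nat. (a + w / 2, b + (real i + 1 / 2) * w)) ` {..nat \<lfloor>h / w\<rfloor>}"
  have "card F \<le> card {..nat \<lfloor>h / w\<rfloor>}" unfolding F_def by (rule card_image_le) simp
  then have "real (card F) \<le> real (nat \<lfloor>h / w\<rfloor>) + 1" by simp
  also have "\<dots> \<le> h / w + 1" using w h by simp
  finally have card: "real (card F) \<le> h / w + 1" .
  have "{a..a + w} \<times> {b..b + h} \<subseteq> (\<Union>p\<in>F. cball p w)"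
  proof clarify
    fix x y assume x: "x \<in> {a..a + w}" and y: "y \<in> {b..b + h}"
    define i where "i = nat \<lfloor>(y - b) / w\<rfloor>"
    have nn: "0 \<le> (y - b) / w" using w y by simp
    have "(y - b) / w \<le> h / w" using w y by (intro divide_right_mono) auto
    then have "i \<le> nat \<lfloor>h / w\<rfloor>" unfolding i_def by (intro nat_mono floor_mono)
    then have mem: "(a + w / 2, b + (real i + 1 / 2) * w) \<in> F" unfolding F_def by blast
    have "real i \<le> (y - b) / w" "(y - b) / w \<le> real i + 1" using nn unfolding i_def by linarith+
    then have "real i * w \<le> y - b" "y - b \<le> (real i + 1) * w" using w by (auto simp: field_simps)
    then have "\<bar>(b + (real i + 1 / 2) * w) - y\<bar> \<le> w / 2"
      by (simp only: abs_le_iff distrib_right) linarith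
    moreover have "\<bar>(a + w / 2) - x\<bar> \<le> w / 2" using x by (simp only: abs_le_iff atLeastAtMost_iff) linarith
    ultimately have "dist (a + w / 2, b + (real i + 1 / 2) * w) (x, y) \<le> w"
      using dist_prod_le[of "a + w / 2" "b + (real i + 1 / 2) * w" x y] by linarith
    then show "(x, y) \<in> (\<Union>p\<in>F. cball p w)" using mem by auto
  qed
  then show ?thesis using card by (intro exI[of _ F]) (auto simp: F_def)
qed

context takagi_parameter begin

lemma near_strip_descendants:
  assumes "i < 2 ^ m" "h / lam ^ m \<le> real K * (lam ^ k / 2)"
  shows "card {u \<in> near 0 c h (m + k). u div 2 ^ k = i} \<le> (2 * K + 2) * max_count k"
proof -
  obtain a where a: "\<bar>a\<bar> \<le> slope_bound * (1 - 1 / (2 * lam) ^ m)"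
    "\<forall>s c. \<exists>c'. \<forall>h n. card {k \<in> near s c h (m + n). k div 2 ^ n = i}
     \<le> card (near (s / (2 * lam) ^ m - a) c' (h / lam ^ m) n)"
    using near_descendants[OF assms(1)] by (elim exE conjE) (rule that)
  obtain c' where "card {u \<in> near 0 c h (m + k). u div 2 ^ k = i}
     \<le> card (near (0 / (2 * lam) ^ m - a) c' (h / lam ^ m) k)" using a(2) by meson
  also have "\<dots> \<le> (2 * K + 2) * max_count k"
    using slope_bound_ge by (intro card_near_strip slope_renormalised_bounded a(1) assms(2)) auto
  finally show ?thesis .
qed

definition strip_piece :: "nat \<Rightarrow> nat \<Rightarrow> real \<Rightarrow> (real \<times> real) set" where
  "strip_piece m i c = {(y, T y) | y x. x \<in> {0..1} \<and> y = (real i + x) / 2 ^ m \<and> \<bar>T y - c\<bar> \<le> T_bound / 2 ^ m}"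

text \<open>Consider the part of a piece of level \<open>m\<close> in a horizontal strip of thickness comparable to
  the width \<open>2 ^ - m\<close> of the piece, at the scale \<open>2 ^ - (m + n)\<close>.  Renormalisation turns the strip
  into a thin neighbourhood of a line with slope in the attractor.  As long as the subpieces are
  taller than the strip, say down to level \<open>m + k\<close>, those meeting it are counted by
  \<open>max_count k\<close>.  Below that level all subpieces may meet the strip, but their heights shrink;
  these account for the factor \<open>(2 * lam) ^ (n - k)\<close>, which is at most \<open>2 powr (growth * (n - k))\<close>.\<close>

lemma cover_strip_piece:
  assumes t: "growth < t"
  shows "\<exists>C>0. \<forall>m n i c. i < 2 ^ m \<longrightarrow> (\<exists>F. finite F \<and> real (card F) \<le> C * (2 powr (1 + t)) ^ n \<and>
     strip_piece m i c \<subseteq> (\<Union>p\<in>F. cball p (1 / 2 ^ (m + n))))"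
proof -
  obtain C where C: "C > 0" "\<And>n. real (max_count n) \<le> C * 2 powr (t * real n)"
    using max_count_upper[OF t] by blast
  define K where "K = nat \<lceil>2 * T_bound\<rceil>"
  define H where "H = 4 * (T_bound + slope_bound)"
  have H: "H > 0" using T_bound_ge slope_bound_ge by (simp add: H_def)
  have K: "2 * T_bound \<le> real K" unfolding K_def by linarith
  define A where "A = (2 * real K + 2) * C * (H + 1)"
  have "\<exists>F. finite F \<and> real (card F) \<le> A * (2 powr (1 + t)) ^ n \<and>
     strip_piece m i c \<subseteq> (\<Union>p\<in>F. cball p (1 / 2 ^ (m + n)))" if i: "i < 2 ^ m" for m n i c
  proof -
    define h where "h = T_bound / 2 ^ m"
    have "(1 / 2) ^ m \<le> lam ^ m" using lam_gt by (intro power_mono) auto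
    then have in0: "0 \<in> {k. k \<le> n \<and> 1 / 2 ^ m \<le> lam ^ (m + k)}" by (simp add: power_divide)
    have fin: "finite {k. k \<le> n \<and> 1 / 2 ^ m \<le> lam ^ (m + k)}" by simp
    define k where "k = Max {k. k \<le> n \<and> 1 / 2 ^ m \<le> lam ^ (m + k)}"
    have k: "k \<le> n" "1 / 2 ^ m \<le> lam ^ (m + k)"
      using Max_in[OF fin] in0 unfolding k_def[symmetric] by blast+
    have kmax: "lam ^ (m + Suc k) < 1 / 2 ^ m" if "k < n"
    proof (rule ccontr)
      assume "\<not> ?thesis"
      then have "Suc k \<le> k" unfolding k_def[symmetric] using that fin
        by (subst (2) k_def, intro Max_ge) auto
      then show False by simp
    qed
    define Q where "Q = {v \<in> near 0 c h (m + n). v div 2 ^ n = i}"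
    have hK: "h / lam ^ m \<le> real K * (lam ^ k / 2)"
    proof -
      have "h \<le> T_bound * lam ^ (m + k)"
        using k(2) T_bound_ge mult_left_mono[of "1 / 2 ^ m" "lam ^ (m + k)" T_bound] by (simp add: h_def)
      then have "h / lam ^ m \<le> 2 * T_bound * (lam ^ k / 2)" by (simp add: power_add field_simps)
      also have "\<dots> \<le> real K * (lam ^ k / 2)" using K by (intro mult_right_mono) auto
      finally show ?thesis .
    qed
    have "Q \<subseteq> (\<Union>u\<in>{u \<in> near 0 c h (m + k). u div 2 ^ k = i}. {v \<in> Q. v div 2 ^ (n - k) = u})"
    proof
      fix v assume v: "v \<in> Q"
      have "v div 2 ^ (n - k) \<in> near 0 c h (m + k)"
        using v k(1) near_ancestor[of v 0 c h "m + k" "n - k"] by (simp add: Q_def)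
      moreover have "v div 2 ^ (n - k) div 2 ^ k = i"
        using v k(1) by (simp add: Q_def div_mult2_eq[symmetric] power_add[symmetric])
      ultimately show "v \<in> (\<Union>u\<in>{u \<in> near 0 c h (m + k). u div 2 ^ k = i}. {v \<in> Q. v div 2 ^ (n - k) = u})"
        using v by blast
    qed
    then have "card Q \<le> card (\<Union>u\<in>{u \<in> near 0 c h (m + k). u div 2 ^ k = i}. {v \<in> Q. v div 2 ^ (n - k) = u})"
      by (intro card_mono) (auto simp: Q_def)
    also have "\<dots> \<le> (\<Sum>u\<in>{u \<in> near 0 c h (m + k). u div 2 ^ k = i}. card {v \<in> Q. v div 2 ^ (n - k) = u})"
      by (rule card_UN_le) simp
    also have "\<dots> \<le> (\<Sum>u\<in>{u \<in> near 0 c h (m + k). u div 2 ^ k = i}. 2 ^ (n - k))"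
      by (intro sum_mono card_div_fibre) simp
    also have "\<dots> = card {u \<in> near 0 c h (m + k). u div 2 ^ k = i} * 2 ^ (n - k)" by simp
    also have "\<dots> \<le> (2 * K + 2) * max_count k * 2 ^ (n - k)"
      by (intro mult_right_mono near_strip_descendants i hK) simp
    finally have "real (card Q) \<le> real ((2 * K + 2) * max_count k * 2 ^ (n - k))" by (rule of_nat_mono)
    then have cardQ: "real (card Q) \<le> (2 * real K + 2) * real (max_count k) * 2 ^ (n - k)" by (simp add: algebra_simps)
    define w :: real where "w = 1 / 2 ^ (m + n)"
    have w: "w > 0" by (simp add: w_def)
    (* If k = n, subpieces are still as tall as 2 ^ - m at level m + n and the strip is what limits the
       heights; otherwise the subpieces themselves are short. *)
    define b where "b v = (if k = n then c - h else T (real v / 2 ^ (m + n)) - H / 4 * lam ^ (m + n))" for v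
    define Hk where "Hk = H * lam ^ (n - k) / 2 ^ m"
    have window: "T y \<in> {b v..b v + Hk}"
      if "v < 2 ^ (m + n)" "x \<in> {0..1}" "y = (real v + x) / 2 ^ (m + n)" "\<bar>T y - c\<bar> \<le> h" for v x y
    proof (cases "k = n")
      case True
      have "2 * T_bound \<le> H" using T_bound_ge slope_bound_ge by (simp add: H_def)
      then have "2 * h \<le> Hk" using True by (simp add: Hk_def h_def divide_right_mono)
      then show ?thesis using that(4) True by (auto simp: b_def abs_le_iff)
    next
      case False
      then have kn: "k < n" using k(1) by simp
      have "\<bar>height 0 (m + n) v x - height 0 (m + n) v 0\<bar> \<le> lam ^ (m + n) * (T_bound + slope_bound)"
        using that slope_bound_ge by (intro height_variation) auto
      moreover have "H / 4 = T_bound + slope_bound" by (simp add: H_def)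
      ultimately have 1: "\<bar>T y - T (real v / 2 ^ (m + n))\<bar> \<le> H / 4 * lam ^ (m + n)"
        unfolding that(3) by (simp only: height_def mult.commute) simp
      have "lam ^ (m + n) = lam ^ (m + Suc k) * lam ^ (n - Suc k)"
        by (subst power_add[symmetric]) (use kn in simp)
      also have "\<dots> \<le> 1 / 2 ^ m * lam ^ (n - Suc k)" using kmax[OF kn] by (intro mult_right_mono) auto
      also have "\<dots> \<le> 1 / 2 ^ m * (2 * lam ^ (n - k))"
      proof (intro mult_left_mono)
        have "lam ^ (n - k) = lam * lam ^ (n - Suc k)" using kn by (metis Suc_diff_Suc power_Suc)
        then show "lam ^ (n - Suc k) \<le> 2 * lam ^ (n - k)" using lam_gt by simp
      qed simp
      finally have "H / 2 * lam ^ (m + n) \<le> H / 2 * (1 / 2 ^ m * (2 * lam ^ (n - k)))"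
        using H by (intro mult_left_mono) auto
      then have "H / 2 * lam ^ (m + n) \<le> Hk" by (simp add: Hk_def)
      then show ?thesis using 1[unfolded abs_le_iff] unfolding b_def if_not_P[OF False] atLeastAtMost_iff
        by linarith
    qed
    have "0 \<le> Hk" using H by (simp add: Hk_def)
    then have "\<forall>v. \<exists>F. finite F \<and> real (card F) \<le> Hk / w + 1 \<and>
       {real v / 2 ^ (m + n)..real v / 2 ^ (m + n) + w} \<times> {b v..b v + Hk} \<subseteq> (\<Union>p\<in>F. cball p w)"
      using cover_rectangle[OF w] by blast
    then obtain F where F: "\<And>v. finite (F v)" "\<And>v. real (card (F v)) \<le> Hk / w + 1"
      "\<And>v. {real v / 2 ^ (m + n)..real v / 2 ^ (m + n) + w} \<times> {b v..b v + Hk} \<subseteq> (\<Union>p\<in>F v. cball p w)"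
      by metis
    have finQ: "finite Q" by (simp add: Q_def)
    have cover: "strip_piece m i c \<subseteq> (\<Union>p\<in>(\<Union>v\<in>Q. F v). cball p w)"
    proof
      fix p assume "p \<in> strip_piece m i c"
      then obtain x where x: "x \<in> {0..1}" and p: "p = ((real i + x) / 2 ^ m, T ((real i + x) / 2 ^ m))"
        and strip: "\<bar>T ((real i + x) / 2 ^ m) - c\<bar> \<le> h" by (auto simp: strip_piece_def h_def)
      obtain l z where lz: "l < 2 ^ n" "z \<in> {0..1}" "x = (real l + z) / 2 ^ n"
        using dyadic_index[OF x] .
      define v where "v = i * 2 ^ n + l"
      have v: "v div 2 ^ n = i" "v mod 2 ^ n = l" using lz(1) by (auto simp: v_def)
      have "(i + 1) * 2 ^ n \<le> 2 ^ m * 2 ^ n" using i by (intro mult_right_mono) auto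
      then have v_less: "v < 2 ^ (m + n)" using lz(1) by (simp add: v_def power_add)
      define y where "y = (real v + z) / 2 ^ (m + n)"
      have y: "y = (real i + x) / 2 ^ m" unfolding y_def dyadic_child_point v lz(3) ..
      have "v \<in> Q" using v_less v(1) lz(2) strip unfolding Q_def near_def height_def y[symmetric] y_def by auto
      moreover have "T y \<in> {b v..b v + Hk}"
        using v_less lz(2) strip y by (intro window[of v z y]) (auto simp: y_def)
      moreover have "y \<in> {real v / 2 ^ (m + n)..real v / 2 ^ (m + n) + w}"
        using lz(2) by (auto simp: y_def w_def add_divide_distrib divide_right_mono)
      ultimately show "p \<in> (\<Union>p\<in>(\<Union>v\<in>Q. F v). cball p w)"
        using F(3)[of v] unfolding p y[symmetric] by blast
    qed
    have kn: "1 \<le> lam ^ (n - k) * 2 ^ n"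
    proof -
      have "1 \<le> (2 * lam) ^ (n - k)" using lam_gt by (intro one_le_power) simp
      also have "\<dots> = lam ^ (n - k) * 2 ^ (n - k)" by (simp add: power_mult_distrib)
      also have "\<dots> \<le> lam ^ (n - k) * 2 ^ n" by (intro mult_left_mono power_increasing) auto
      finally show ?thesis .
    qed
    have "real (card (\<Union>v\<in>Q. F v)) \<le> (\<Sum>v\<in>Q. real (card (F v)))"
      using card_UN_le[OF finQ, of F] by (metis of_nat_le_iff of_nat_sum)
    also have "\<dots> \<le> (\<Sum>v\<in>Q. (H + 1) * (lam ^ (n - k) * 2 ^ n))"
    proof (intro sum_mono)
      fix v
      have "Hk / w = H * (lam ^ (n - k) * 2 ^ n)" by (simp add: Hk_def w_def power_add)
      then show "real (card (F v)) \<le> (H + 1) * (lam ^ (n - k) * 2 ^ n)"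
        using F(2)[of v] kn by (simp add: distrib_right)
    qed
    also have "\<dots> = real (card Q) * ((H + 1) * (lam ^ (n - k) * 2 ^ n))" by simp
    also have "\<dots> \<le> ((2 * real K + 2) * (C * 2 powr (t * real k)) * 2 ^ (n - k)) * ((H + 1) * (lam ^ (n - k) * 2 ^ n))"
    proof (intro mult_right_mono)
      have "(2 * real K + 2) * real (max_count k) * 2 ^ (n - k) \<le> (2 * real K + 2) * (C * 2 powr (t * real k)) * 2 ^ (n - k)"
        by (intro mult_left_mono mult_right_mono C) auto
      then show "real (card Q) \<le> (2 * real K + 2) * (C * 2 powr (t * real k)) * 2 ^ (n - k)" using cardQ by linarith
    qed (use H in auto)
    also have "\<dots> = A * 2 ^ n * ((2 powr t) ^ k * (2 * lam) ^ (n - k))"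
      by (simp add: A_def powr_mult_nat power_mult_distrib)
    also have "\<dots> \<le> A * 2 ^ n * ((2 powr t) ^ k * (2 powr t) ^ (n - k))"
    proof (intro mult_left_mono power_mono)
      have "2 powr growth \<le> 2 powr t" using t by simp
      then show "2 * lam \<le> 2 powr t" using two_lam_le by linarith
    qed (use C H in \<open>auto simp: A_def\<close>)
    also have "\<dots> = A * (2 powr (1 + t)) ^ n"
      using k(1) by (simp add: power_add[symmetric] powr_add power_mult_distrib)
    finally show ?thesis using cover finQ F(1) unfolding w_def by (intro exI[of _ "\<Union>v\<in>Q. F v"]) auto
  qed
  moreover have "A > 0" using C H by (auto simp: A_def intro!: mult_pos_pos)
  ultimately show ?thesis by blast
qed

text \<open>A ball of radius \<open>R \<le> 1\<close> is covered by the strips over a bounded number of dyadic intervals of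
  length about \<open>R\<close>; for \<open>R > 1\<close> the whole graph is the strip over the only piece of level \<open>0\<close>.\<close>

lemma covering_number_graph:
  assumes t: "growth < t"
  shows "\<exists>C>0. \<forall>p\<in>takagi_graph lam. \<forall>r R. 0 < r \<and> r < R \<longrightarrow>
    ereal_of_enat (covering_number r (takagi_graph lam \<inter> cball p R)) \<le> ereal (C * (R / r) powr (1 + t))"
proof -
  obtain C where C: "C > 0" "\<And>m n i c. i < 2 ^ m \<Longrightarrow> (\<exists>F. finite F \<and> real (card F) \<le> C * (2 powr (1 + t)) ^ n \<and>
     strip_piece m i c \<subseteq> (\<Union>p\<in>F. cball p (1 / 2 ^ (m + n))))"
    using cover_strip_piece[OF t] by blast
  have t0: "0 < 1 + t" using t growth_pos by simp
  have "ereal_of_enat (covering_number r (takagi_graph lam \<inter> cball p R))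
      \<le> ereal ((7 * C * 4 powr (1 + t)) * (R / r) powr (1 + t))"
    if p: "p \<in> takagi_graph lam" and r: "0 < r" "r < R" for p r R
  proof -
    obtain x0 where x0: "x0 \<in> {0..1}" "p = (x0, T x0)" using p by (auto simp: takagi_graph_def)
    obtain m where m: "R \<le> 1 \<Longrightarrow> R * 2 ^ m \<le> 1" "1 < R \<Longrightarrow> m = 0" "1 \<le> 2 * R * 2 ^ m"
    proof (cases "1 < R")
      case True
      then show ?thesis using that[of 0] by simp
    next
      case False
      then obtain m where "R * 2 ^ m \<le> 1" "1 < 2 * R * 2 ^ m"
        using exists_dyadic_scale[of R] r by auto
      then show ?thesis using that[of m] False by simp
    qed
    define P where "P n \<longleftrightarrow> 1 / 2 ^ (m + n) \<le> r" for n
    obtain n1 where "1 / r < 2 ^ n1" using real_arch_pow[of 2 "1 / r"] by auto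
    then have "1 < r * 2 ^ n1" using r by (simp add: field_simps)
    also have "\<dots> \<le> r * 2 ^ (m + n1)" using r by (intro mult_left_mono power_increasing) auto
    finally have "P n1" by (simp add: P_def field_simps)
    (* Minimality keeps 2 ^ n at most 4 * (R / r), also if r exceeds 2 ^ - m and therefore n = 0. *)
    define n where "n = (LEAST n. P n)"
    have n: "P n" unfolding n_def using \<open>P n1\<close> by (rule LeastI)
    have n4: "2 ^ n \<le> 4 * (R / r)"
    proof (cases n)
      case 0
      then show ?thesis using r by (simp add: field_simps)
    next
      case (Suc n')
      then have "\<not> P n'" unfolding n_def using not_less_Least[of n' P] by simp
      then have "r * 2 ^ m * 2 ^ n' < 1" using r by (simp add: P_def field_simps power_add)
      also note m(3)
      finally have "(r * 2 ^ n') * 2 ^ m < (2 * R) * 2 ^ m" by (simp add: mult_ac)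
      then have "r * 2 ^ n' < 2 * R" by simp
      then show ?thesis using r by (simp add: Suc field_simps)
    qed
    define I where "I = {i. i < 2 ^ m \<and> \<bar>real i - x0 * 2 ^ m\<bar> \<le> 3}"
    have finI: "finite I" unfolding I_def by (rule finite_subset[OF _ card_nat_near_le(1)]) auto
    have "card I \<le> card {i. \<bar>real i - x0 * 2 ^ m\<bar> \<le> 3}"
      unfolding I_def by (intro card_mono card_nat_near_le(1)) auto
    then have cardI: "real (card I) \<le> 7" using card_nat_near_le(2)[of 3 "x0 * 2 ^ m"] by simp
    have sub: "takagi_graph lam \<inter> cball p R \<subseteq> (\<Union>i\<in>I. strip_piece m i (T x0))"
    proof
      fix q assume q: "q \<in> takagi_graph lam \<inter> cball p R"
      then obtain y where y: "y \<in> {0..1}" "q = (y, T y)" by (auto simp: takagi_graph_def)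
      have "dist p q \<le> R" using q by simp
      then have yR: "\<bar>x0 - y\<bar> \<le> R" "\<bar>T x0 - T y\<bar> \<le> R"
        using dist_fst_le[of p q] dist_snd_le[of p q] by (auto simp: x0(2) y(2) dist_real_def)
      obtain i x where i: "i < 2 ^ m" and x: "x \<in> {0..1}" and yx: "y = (real i + x) / 2 ^ m"
        using dyadic_index[OF y(1)] .
      have "\<bar>T y - T x0\<bar> \<le> T_bound / 2 ^ m \<and> \<bar>x0 * 2 ^ m - y * 2 ^ m\<bar> \<le> 1"
      proof (cases "1 < R")
        case True
        then show ?thesis using m(2) x0(1) y(1) T_nonneg[of y] T_le[of y] T_nonneg[of x0] T_le[of x0]
          by (auto simp: abs_le_iff)
      next
        case False
        then have R: "R * 2 ^ m \<le> 1" using m(1) by simp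
        have "\<bar>T y - T x0\<bar> * 2 ^ m \<le> R * 2 ^ m" using yR by (intro mult_right_mono) auto
        then have "\<bar>T y - T x0\<bar> * 2 ^ m \<le> T_bound" using R T_bound_ge by linarith
        moreover have "\<bar>x0 - y\<bar> * 2 ^ m \<le> 1"
          by (rule order_trans[OF mult_right_mono[OF yR(1)] R]) simp
        ultimately show ?thesis by (simp add: pos_le_divide_eq abs_mult left_diff_distrib[symmetric])
      qed
      moreover have "y * 2 ^ m = real i + x" using yx by simp
      ultimately have "\<bar>T y - T x0\<bar> \<le> T_bound / 2 ^ m" "i \<in> I" using i x by (auto simp: I_def)
      then show "q \<in> (\<Union>i\<in>I. strip_piece m i (T x0))"
        unfolding strip_piece_def y(2) using x yx by blast
    qed
    have "\<forall>i. \<exists>F. i \<in> I \<longrightarrow> finite F \<and> real (card F) \<le> C * (2 powr (1 + t)) ^ n \<and>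
      strip_piece m i (T x0) \<subseteq> (\<Union>p\<in>F. cball p (1 / 2 ^ (m + n)))"
      using C(2)[of _ m n "T x0"] by (auto simp: I_def)
    then obtain F where F: "\<And>i. i \<in> I \<Longrightarrow> finite (F i)"
      "\<And>i. i \<in> I \<Longrightarrow> real (card (F i)) \<le> C * (2 powr (1 + t)) ^ n"
      "\<And>i. i \<in> I \<Longrightarrow> strip_piece m i (T x0) \<subseteq> (\<Union>p\<in>F i. cball p (1 / 2 ^ (m + n)))" by metis
    define G where "G = (\<Union>i\<in>I. F i)"
    have "strip_piece m i (T x0) \<subseteq> (\<Union>p\<in>G. cball p r)" if "i \<in> I" for i
    proof -
      have "(\<Union>p\<in>F i. cball p (1 / 2 ^ (m + n))) \<subseteq> (\<Union>p\<in>G. cball p r)"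
        by (rule UN_mono) (use that n in \<open>auto simp: G_def P_def\<close>)
      then show ?thesis using F(3)[OF that] by (rule order_trans[rotated])
    qed
    then have "takagi_graph lam \<inter> cball p R \<subseteq> (\<Union>p\<in>G. cball p r)"
      using sub by (meson UN_least order_trans)
    moreover have "finite G" unfolding G_def using finI F(1) by blast
    ultimately have "covering_number r (takagi_graph lam \<inter> cball p R) \<le> enat (card G)"
      by (intro covering_number_le)
    then have "ereal_of_enat (covering_number r (takagi_graph lam \<inter> cball p R)) \<le> ereal_of_enat (enat (card G))"
      by (simp only: ereal_of_enat_le_iff)
    also have "\<dots> = ereal (real (card G))" by simp
    also have "\<dots> \<le> ereal ((7 * C * 4 powr (1 + t)) * (R / r) powr (1 + t))"
    proof -
      have "real (card G) \<le> (\<Sum>i\<in>I. real (card (F i)))"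
        unfolding G_def using card_UN_le[OF finI, of F] by (metis of_nat_le_iff of_nat_sum)
      also have "\<dots> \<le> (\<Sum>i\<in>I. C * (2 powr (1 + t)) ^ n)" by (intro sum_mono F(2))
      also have "\<dots> = real (card I) * (C * (2 powr (1 + t)) ^ n)" by simp
      also have "\<dots> \<le> 7 * (C * (2 powr (1 + t)) ^ n)" using C(1) cardI by (intro mult_right_mono) auto
      also have "(2 powr (1 + t)) ^ n = (2 ^ n) powr (1 + t)"
        by (simp add: powr_mult_nat[symmetric] powr_realpow[symmetric] powr_powr mult.commute)
      also have "7 * (C * (2 ^ n) powr (1 + t)) \<le> 7 * (C * (4 * (R / r)) powr (1 + t))"
        using C(1) n4 t0 by (intro mult_left_mono powr_mono2) auto
      also have "\<dots> = (7 * C * 4 powr (1 + t)) * (R / r) powr (1 + t)"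
        using r by (subst powr_mult) auto
      finally show ?thesis by simp
    qed
    finally show ?thesis .
  qed
  then show ?thesis using C(1) by (intro exI[of _ "7 * C * 4 powr (1 + t)"]) auto
qed

lemma assouad_dim_le: "assouad_dim (takagi_graph lam) \<le> ereal (1 + growth)"
proof (rule ereal_le_epsilon2)
  fix e :: real assume e: "0 < e"
  have "assouad_dim (takagi_graph lam) \<le> ereal (1 + (growth + e))"
    unfolding assouad_dim_def
  proof (rule Inf_lower, rule CollectI, rule exI[of _ "1 + (growth + e)"], intro conjI refl)
    show "0 < 1 + (growth + e)" using e growth_pos by simp
  qed (use covering_number_graph[of "growth + e"] e in simp)
  then show "assouad_dim (takagi_graph lam) \<le> ereal (1 + growth) + ereal e" by (simp add: add.assoc)
qed

section \<open>Assouad dimension from below\<close>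

text \<open>A line meeting \<open>max_count n\<close> pieces of level \<open>n\<close> is lifted into a piece of a level \<open>m\<close> so deep
  that its subpieces of level \<open>m + n\<close> are at least twice as tall as its width \<open>2 ^ - m\<close>.  In a ball of radius
  about \<open>2 ^ - m\<close> around a point of the lifted line, each of the \<open>max_count n\<close> subpieces then runs
  through about \<open>2 ^ n\<close> different heights at scale \<open>2 ^ - (m + n)\<close>.\<close>

lemma covering_number_lower:
  fixes n :: nat
  assumes n: "0 < n"
  shows "\<exists>p\<in>takagi_graph lam. \<exists>r R. 0 < r \<and> r < R \<and> R / r = 4 * (slope_bound + 1) * (slope_bound + 3) * 2 ^ n \<and>
    enat (max_count n * 2 ^ (n - 1)) \<le> covering_number r (takagi_graph lam \<inter> cball p R)"
proof -
  obtain s0 c0 where s0: "\<bar>s0\<bar> \<le> slope_bound" and c0: "card (near s0 c0 0 n) = max_count n"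
    by (rule max_count_attained)
  (* At this depth m the subpieces of level m + n are at least 2 * 2 ^ - m tall. *)
  obtain m where "4 / lam ^ n < (2 * lam) ^ m" using real_arch_pow[of "2 * lam" "4 / lam ^ n"] lam_gt by auto
  then have m: "2 / 2 ^ m \<le> lam ^ (m + n) / 2" by (simp add: field_simps power_add power_mult_distrib)
  obtain j s c where j: "j < 2 ^ m" and s: "\<bar>s\<bar> \<le> slope_bound"
    and lift: "\<And>x. x \<in> {0..1} \<Longrightarrow> T ((real j + x) / 2 ^ m) - s * ((real j + x) / 2 ^ m) - c = lam ^ m * (T x - s0 * x)"
    using slope_lift[OF s0, of m] by blast
  define c1 where "c1 = c + lam ^ m * c0"
  define V where "V = (\<lambda>k. j * 2 ^ n + k) ` near s0 c0 0 n"
  have cardV: "card V = max_count n" unfolding V_def c0[symmetric] by (rule card_image) simp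
  define r where "r = 1 / (2::real) ^ (m + n)"
  define \<rho> where "\<rho> = 1 / (2::real) ^ m"
  have r: "r > 0" "\<rho> = 2 ^ n * r" by (auto simp: r_def \<rho>_def power_add)
  have V: "v < 2 ^ (m + n) \<and> v div 2 ^ n = j \<and> (\<exists>x\<in>{0..1}. height s (m + n) v x = c1)" if "v \<in> V" for v
  proof -
    from that obtain k where k: "k \<in> near s0 c0 0 n" and v: "v = j * 2 ^ n + k" by (auto simp: V_def)
    from k obtain x where x: "k < 2 ^ n" "x \<in> {0..1}" "height s0 n k x = c0" by (auto simp: near_def)
    have "(j + 1) * 2 ^ n \<le> 2 ^ m * 2 ^ n" using j by (intro mult_right_mono) auto
    then have v_less: "v < 2 ^ (m + n)" using x(1) by (simp add: v power_add)
    have vd: "v div 2 ^ n = j" "v mod 2 ^ n = k" using x(1) by (auto simp: v)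
    have "height s (m + n) v x = c1"
      using lift[OF dyadic_point[OF x(1,2)]] x(3) unfolding height_child vd
      by (simp add: height_def c1_def algebra_simps)
    then show ?thesis using v_less vd x by blast
  qed
  have "\<exists>\<sigma>\<in>{1, -1}. \<forall>i\<in>{..<2 ^ n}. \<exists>x\<in>{0..1}. height s (m + n) v x = c1 + \<sigma> * (real i * r)"
    if v: "v \<in> V" for v
  proof -
    obtain x where x: "x \<in> {0..1}" "height s (m + n) v x = c1" using V[OF v] by blast
    obtain p where p: "p \<le> c1" "c1 \<le> p + lam ^ (m + n) / 2"
      "{p..p + lam ^ (m + n) / 2} \<subseteq> height s (m + n) v ` {0..1}"
      using height_window[of v "m + n" x s] V[OF v] x by metis
    have i: "0 \<le> real i * r" "real i * r \<le> \<rho>" if "i \<in> {..<2 ^ n}" for i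
    proof -
      have "real i \<le> 2 ^ n" using that by (metis lessThan_iff less_imp_le of_nat_le_iff of_nat_numeral of_nat_power)
      then show "real i * r \<le> \<rho>" unfolding r(2) using r(1) by (intro mult_right_mono) auto
    qed (use r in simp)
    have \<rho>: "2 * \<rho> \<le> lam ^ (m + n) / 2" using m by (simp add: \<rho>_def)
    (* The window has length at least 2 * \<rho> and contains c1, so it extends by \<rho> above or below c1. *)
    have "\<exists>\<sigma>\<in>{1, -1}. \<forall>i\<in>{..<2 ^ n}. c1 + \<sigma> * (real i * r) \<in> {p..p + lam ^ (m + n) / 2}"
    proof (cases "c1 + \<rho> \<le> p + lam ^ (m + n) / 2")
      case True
      then show ?thesis using p i by (intro bexI[of _ 1]) fastforce+
    next
      case False
      then have "p \<le> c1 - \<rho>" using \<rho> by linarith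
      then show ?thesis using p i by (intro bexI[of _ "-1"]) fastforce+
    qed
    then obtain \<sigma> where \<sigma>: "\<sigma> \<in> {1, -1}"
      "\<forall>i\<in>{..<2 ^ n}. c1 + \<sigma> * (real i * r) \<in> {p..p + lam ^ (m + n) / 2}" by blast
    have "\<exists>x\<in>{0..1}. height s (m + n) v x = c1 + \<sigma> * (real i * r)" if "i \<in> {..<2 ^ n}" for i
    proof -
      have "c1 + \<sigma> * (real i * r) \<in> height s (m + n) v ` {0..1}" using \<sigma>(2) that p(3) by blast
      then show ?thesis by (metis imageE)
    qed
    then show ?thesis using \<sigma>(1) by blast
  qed
  then have "\<forall>v\<in>V. \<exists>\<sigma>. \<sigma> \<in> {1, -1} \<and>
      (\<forall>i\<in>{..<2 ^ n}. \<exists>x\<in>{0..1}. height s (m + n) v x = c1 + \<sigma> * (real i * r))" by blast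
  from bchoice[OF this] obtain \<sigma> where \<sigma>: "\<And>v. v \<in> V \<Longrightarrow> \<sigma> v \<in> {1, -1}"
    "\<And>v i. v \<in> V \<Longrightarrow> i \<in> {..<2 ^ n} \<Longrightarrow> \<exists>x\<in>{0..1}. height s (m + n) v x = c1 + \<sigma> v * (real i * r)" by blast
  define D where "D = V \<times> {..<(2::nat) ^ n}"
  have "\<forall>d\<in>D. \<exists>x. x \<in> {0..1} \<and> height s (m + n) (fst d) x = c1 + \<sigma> (fst d) * (real (snd d) * r)"
  proof
    fix d assume "d \<in> D"
    then have "fst d \<in> V" "snd d \<in> {..<2 ^ n}" by (auto simp: D_def)
    from \<sigma>(2)[OF this]
    show "\<exists>x. x \<in> {0..1} \<and> height s (m + n) (fst d) x = c1 + \<sigma> (fst d) * (real (snd d) * r)" by blast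
  qed
  from bchoice[OF this] obtain X' where X': "\<And>d. d \<in> D \<Longrightarrow> X' d \<in> {0..1}"
    "\<And>d. d \<in> D \<Longrightarrow> height s (m + n) (fst d) (X' d) = c1 + \<sigma> (fst d) * (real (snd d) * r)" by blast
  define X where "X v i = X' (v, i)" for v i
  have X: "X v i \<in> {0..1}" "height s (m + n) v (X v i) = c1 + \<sigma> v * (real i * r)"
    if "v \<in> V" "i \<in> {..<2 ^ n}" for v i
    using X'[of "(v, i)"] that by (auto simp: X_def D_def)
  define Y where "Y v i = (real v + X v i) / 2 ^ (m + n)" for v i
  define Z where "Z d = (Y (fst d) (snd d), T (Y (fst d) (snd d)))" for d
  have TY: "T (Y v i) = s * Y v i + c1 + \<sigma> v * (real i * r)" if "v \<in> V" "i \<in> {..<2 ^ n}" for v i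
    using X(2)[OF that] by (simp add: height_def Y_def)
  have Y_range: "Y v i \<in> {0..1}" "\<bar>Y v i - Y v' i'\<bar> \<le> \<rho>"
    if "v \<in> V" "i \<in> {..<2 ^ n}" "v' \<in> V" "i' \<in> {..<2 ^ n}" for v i v' i'
  proof -
    show "Y v i \<in> {0..1}" unfolding Y_def using V X that by (intro dyadic_point) auto
    have "\<exists>z\<in>{0..1}. Y v i = (real j + z) / 2 ^ m" if "v \<in> V" "i \<in> {..<2 ^ n}" for v i
    proof (intro bexI)
      show "Y v i = (real j + (real (v mod 2 ^ n) + X v i) / 2 ^ n) / 2 ^ m"
        unfolding Y_def dyadic_child_point using V that by simp
      show "(real (v mod 2 ^ n) + X v i) / 2 ^ n \<in> {0..1}" using X that by (intro dyadic_point) auto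
    qed
    from this[OF that(1,2)] this[OF that(3,4)] obtain z z' where z: "z \<in> {0..1}" "z' \<in> {0..1}"
      "Y v i = (real j + z) / 2 ^ m" "Y v' i' = (real j + z') / 2 ^ m" by blast
    have "Y v i - Y v' i' = (z - z') / 2 ^ m" unfolding z by (simp add: diff_divide_distrib add_divide_distrib)
    moreover have "\<bar>z - z'\<bar> \<le> 1" using z(1,2) by (auto simp: abs_le_iff)
    ultimately show "\<bar>Y v i - Y v' i'\<bar> \<le> \<rho>" by (simp add: \<rho>_def divide_right_mono)
  qed
  define r' where "r' = r / (4 * (slope_bound + 1))"
  define R where "R = (slope_bound + 3) * \<rho>"
  have sb: "slope_bound > 1" by (rule slope_bound_ge)
  have r'_pos: "r' > 0" using r(1) sb by (simp add: r'_def)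
  have r'_mult: "2 * r' * (slope_bound + 1) = r / 2" using sb by (simp add: r'_def field_simps)
  have "2 * r' * 1 \<le> 2 * r' * (slope_bound + 1)" using r'_pos sb by (intro mult_left_mono) auto
  then have r'_less: "2 * r' < r" using r'_mult r(1) by simp
  note r' = r'_pos r'_mult r'_less
  have "V \<noteq> {}" using cardV max_count_pos[of n] by auto
  then obtain v0 where v0: "v0 \<in> V" by blast
  define p where "p = Z (v0, 0)"
  have p: "p \<in> takagi_graph lam" using Y_range(1)[of v0 0 v0 0] v0 by (auto simp: p_def Z_def takagi_graph_def)
  have Zin: "Z d \<in> takagi_graph lam \<inter> cball p R" if dD: "d \<in> D" for d
  proof -
    obtain v i where d: "d = (v, i)" "v \<in> V" "i \<in> {..<2 ^ n}" using dD by (auto simp: D_def)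
    have "real i \<le> 2 ^ n" using d(3) by (metis lessThan_iff less_imp_le of_nat_le_iff of_nat_numeral of_nat_power)
    then have "real i * r \<le> \<rho>" unfolding r(2) using r(1) by (intro mult_right_mono) auto
    then have i: "\<bar>\<sigma> v * (real i * r)\<bar> \<le> \<rho>" using \<sigma>(1)[OF d(2)] r(1) by auto
    have 1: "\<bar>Y v0 0 - Y v i\<bar> \<le> \<rho>" using Y_range(2)[of v0 0 v i] v0 d by simp
    have "\<bar>s * (Y v0 0 - Y v i)\<bar> \<le> slope_bound * \<rho>"
      unfolding abs_mult using s 1 sb by (intro mult_mono) auto
    moreover have "T (Y v0 0) - T (Y v i) = s * (Y v0 0 - Y v i) - \<sigma> v * (real i * r)"
      using TY[OF v0, of 0] TY[OF d(2,3)] by (simp add: right_diff_distrib)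
    ultimately have "\<bar>T (Y v0 0) - T (Y v i)\<bar> \<le> slope_bound * \<rho> + \<rho>" using i by linarith
    then have "dist p (Z d) \<le> \<rho> + (slope_bound * \<rho> + \<rho>)"
      using 1 dist_prod_le[of "Y v0 0" "T (Y v0 0)" "Y v i" "T (Y v i)"] by (simp add: p_def Z_def d)
    also have "\<dots> \<le> R" using r sb by (simp add: R_def algebra_simps)
    finally show ?thesis using Y_range(1)[of v i v i] d by (auto simp: Z_def takagi_graph_def)
  qed
  (* Neighbouring pieces of level m + n may contain points that are close together; pieces whose
     indices have the same parity do not. *)
  have separated: "v = v' \<and> i = i'"
    if d: "(v, i) \<in> D" "(v', i') \<in> D" and par: "even v = even v'" and near: "dist (Z (v, i)) (Z (v', i')) \<le> 2 * r'"
    for v i v' i'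
  proof -
    have d': "v \<in> V" "i \<in> {..<2 ^ n}" "v' \<in> V" "i' \<in> {..<2 ^ n}" using d by (auto simp: D_def)
    have y: "\<bar>Y v i - Y v' i'\<bar> \<le> 2 * r'" and ty: "\<bar>T (Y v i) - T (Y v' i')\<bar> \<le> 2 * r'"
      using near dist_fst_le[of "Z (v, i)" "Z (v', i')"] dist_snd_le[of "Z (v, i)" "Z (v', i')"]
      by (auto simp: Z_def dist_real_def)
    have "v = v'"
    proof (rule ccontr)
      assume "v \<noteq> v'"
      then have "2 \<le> \<bar>int v - int v'\<bar>" using par by presburger
      then have "2 \<le> \<bar>real v - real v'\<bar>" by linarith
      then have "1 \<le> \<bar>(real v + X v i) - (real v' + X v' i')\<bar>" using X(1)[OF d'(1,2)] X(1)[OF d'(3,4)] by auto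
      then have "r * 1 \<le> r * \<bar>(real v + X v i) - (real v' + X v' i')\<bar>" using r(1) by (intro mult_left_mono) auto
      also have "\<dots> = \<bar>Y v i - Y v' i'\<bar>" by (simp add: Y_def r_def diff_divide_distrib[symmetric])
      finally show False using y r'(3) by simp
    qed
    moreover have "i = i'"
    proof (rule ccontr)
      assume "i \<noteq> i'"
      then have "1 \<le> \<bar>real i - real i'\<bar>" by linarith
      then have "r * 1 \<le> r * \<bar>real i - real i'\<bar>" using r(1) by (intro mult_left_mono) auto
      also have "\<dots> = \<bar>\<sigma> v * (real i * r) - \<sigma> v * (real i' * r)\<bar>"
      proof -
        have eq: "\<bar>\<sigma> v * a - \<sigma> v * b\<bar> = \<bar>a - b\<bar>" for a b using \<sigma>(1)[OF d'(1)] by auto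
        show ?thesis unfolding eq left_diff_distrib[symmetric] abs_mult using r(1) by simp
      qed
      also have "\<sigma> v * (real i * r) - \<sigma> v * (real i' * r) = (T (Y v i) - T (Y v' i')) - s * (Y v i - Y v' i')"
        using TY[OF d'(1,2)] TY[OF d'(3,4)] \<open>v = v'\<close> by (simp add: algebra_simps)
      also have "\<bar>\<dots>\<bar> \<le> \<bar>T (Y v i) - T (Y v' i')\<bar> + \<bar>s * (Y v i - Y v' i')\<bar>" by (rule abs_triangle_ineq4)
      also have "\<dots> \<le> 2 * r' + slope_bound * (2 * r')"
        unfolding abs_mult using s y ty sb by (intro add_mono mult_mono) auto
      also have "\<dots> = r / 2" using r'(2) by (simp add: algebra_simps)
      finally show False using r(1) by simp
    qed
    ultimately show ?thesis by blast
  qed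
  have "enat (max_count n * 2 ^ (n - 1)) \<le> covering_number r' (takagi_graph lam \<inter> cball p R)"
    unfolding covering_number_def
  proof (rule Inf_greatest, clarify)
    fix F assume F: "finite F" "takagi_graph lam \<inter> cball p R \<subseteq> (\<Union>q\<in>F. cball q r')"
    have "\<forall>d. \<exists>q. d \<in> D \<longrightarrow> q \<in> F \<and> dist q (Z d) \<le> r'" using Zin F(2) by fastforce
    then obtain q where q: "\<And>d. d \<in> D \<Longrightarrow> q d \<in> F" "\<And>d. d \<in> D \<Longrightarrow> dist (q d) (Z d) \<le> r'" by metis
    have "inj_on (\<lambda>d. (q d, even (fst d))) D"
    proof (rule inj_onI)
      fix d d' assume d: "d \<in> D" "d' \<in> D" and eq: "(q d, even (fst d)) = (q d', even (fst d'))"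
      have "dist (Z d) (Z d') \<le> dist (q d) (Z d) + dist (q d) (Z d')"
        by (metis dist_commute dist_triangle)
      also have "\<dots> \<le> 2 * r'" using q(2)[OF d(1)] q(2)[OF d(2)] eq by simp
      finally show "d = d'" using separated[of "fst d" "snd d" "fst d'" "snd d'"] d eq by (simp add: prod_eq_iff)
    qed
    then have "card D \<le> card (F \<times> (UNIV :: bool set))"
      by (rule card_inj_on_le) (use q(1) F(1) in auto)
    also have "\<dots> = 2 * card F" by (simp add: card_cartesian_product)
    finally have "max_count n * 2 ^ n \<le> 2 * card F" by (simp add: D_def card_cartesian_product cardV)
    moreover have "(2::nat) ^ n = 2 * 2 ^ (n - 1)" using n by (metis power_eq_if not_gr_zero)
    ultimately show "enat (max_count n * 2 ^ (n - 1)) \<le> enat (card F)" by simp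
  qed
  moreover have "R / r' = 4 * (slope_bound + 1) * (slope_bound + 3) * 2 ^ n"
    using r sb by (simp add: R_def r'_def field_simps)
  moreover have "r' < R"
  proof -
    have "\<rho> \<ge> r" using r one_le_power[of "2::real" n] by simp
    moreover have "1 * \<rho> \<le> (slope_bound + 3) * \<rho>" using sb r by (intro mult_right_mono) auto
    ultimately show ?thesis using r'(1,3) unfolding R_def by linarith
  qed
  ultimately show ?thesis using p r'(1) by blast
qed

lemma assouad_dim_ge: "ereal (1 + growth) \<le> assouad_dim (takagi_graph lam)"
  unfolding assouad_dim_def
proof (rule Inf_greatest, clarify)
  fix s C :: real
  assume s: "0 < s" and C: "0 < C" and bound: "\<forall>p\<in>takagi_graph lam. \<forall>r R. 0 < r \<and> r < R \<longrightarrow>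
    ereal_of_enat (covering_number r (takagi_graph lam \<inter> cball p R)) \<le> ereal (C * (R / r) powr s)"
  define K where "K = 4 * (slope_bound + 1) * (slope_bound + 3)"
  have K: "K > 0" using slope_bound_ge by (simp add: K_def)
  define A where "A = 1 + 2 * C * K powr s"
  have "(2 powr (1 + growth)) ^ n \<le> A * (2 powr s) ^ n" for n
  proof (cases "n = 0")
    case True
    then show ?thesis using C by (simp add: A_def)
  next
    case False
    obtain p r R where p: "p \<in> takagi_graph lam" "0 < r" "r < R" "R / r = K * 2 ^ n"
      "enat (max_count n * 2 ^ (n - 1)) \<le> covering_number r (takagi_graph lam \<inter> cball p R)"
      using covering_number_lower[of n] False unfolding K_def by auto
    have "ereal (real (max_count n * 2 ^ (n - 1))) = ereal_of_enat (enat (max_count n * 2 ^ (n - 1)))" by simp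
    also have "\<dots> \<le> ereal_of_enat (covering_number r (takagi_graph lam \<inter> cball p R))"
      using p(5) by (simp only: ereal_of_enat_le_iff)
    also have "\<dots> \<le> ereal (C * (R / r) powr s)" using bound p by blast
    finally have "real (max_count n) * 2 ^ (n - 1) \<le> C * (K * 2 ^ n) powr s" by (simp add: p(4))
    moreover have "(2::real) ^ n = 2 * 2 ^ (n - 1)" using False by (metis power_eq_if)
    ultimately have 1: "real (max_count n) * 2 ^ n \<le> 2 * C * (K * 2 ^ n) powr s" by simp
    have "(2 powr (1 + growth)) ^ n = 2 powr (growth * real n) * 2 ^ n"
      by (simp add: powr_add power_mult_distrib powr_mult_nat)
    also have "\<dots> \<le> real (max_count n) * 2 ^ n" by (intro mult_right_mono powr_growth_le) simp
    also note 1
    also have "(K * 2 ^ n) powr s = K powr s * (2 powr s) ^ n"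
      using K by (simp add: powr_mult powr_mult_nat[symmetric] powr_realpow[symmetric] powr_powr mult.commute)
    also have "2 * C * (K powr s * (2 powr s) ^ n) \<le> A * (2 powr s) ^ n" by (simp add: A_def distrib_right)
    finally show ?thesis .
  qed
  from le_of_power_bounded[OF _ this] have "2 powr (1 + growth) \<le> 2 powr s" by simp
  then show "ereal (1 + growth) \<le> ereal s" by simp
qed

end

theorem theorem1p1:
  fixes lam :: real
  assumes "1 / 2 < lam" and "lam < 1"
  shows "(\<exists>x\<in>takagi_graph lam. \<exists>V\<in>RP1.
            hausdorff_dim (takagi_graph lam \<inter> (\<lambda>v. v + x) ` V) = assouad_dim (takagi_graph lam) - 1)
       \<and> (\<forall>x\<in>takagi_graph lam. \<forall>V\<in>RP1.
            hausdorff_dim (takagi_graph lam \<inter> (\<lambda>v. v + x) ` V) \<le> assouad_dim (takagi_graph lam) - 1)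
       \<and> assouad_dim (takagi_graph lam) - 1 < 1"
proof -
  interpret takagi_parameter lam using assms by unfold_locales
  have "assouad_dim (takagi_graph lam) = ereal (1 + growth)"
    using assouad_dim_le assouad_dim_ge by (rule antisym)
  then have dim: "assouad_dim (takagi_graph lam) - 1 = ereal growth" by (simp add: one_ereal_def)
  have upper: "hausdorff_dim (takagi_graph lam \<inter> (\<lambda>v. v + x) ` V) \<le> ereal growth"
    if "V \<in> RP1" for x V
  proof -
    obtain a b where x: "x = (a, b)" by (cases x)
    from that[unfolded RP1_iff] show ?thesis
    proof (elim disjE exE)
      assume "V = {(0, t) | t. True}"
      then have "takagi_graph lam \<inter> (\<lambda>v. v + x) ` V \<subseteq> {(a, T a)}" by (auto simp: x takagi_graph_def)
      then have "hausdorff_dim (takagi_graph lam \<inter> (\<lambda>v. v + x) ` V) \<le> 0" by (rule hausdorff_dim_subsingleton)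
      also have "0 \<le> ereal growth" using growth_pos by simp
      finally show ?thesis .
    next
      fix s assume "V = line s 0"
      then show ?thesis using hausdorff_dim_line_le by (simp add: x line_translate)
    qed
  qed
  obtain s c where crit: "\<And>W. dyadic_cut W s c \<Longrightarrow> 1 \<le> cut_sum growth W"
    using exists_critical_line by blast
  have "takagi_graph lam \<inter> line s c \<noteq> {}"
  proof
    assume "takagi_graph lam \<inter> line s c = {}"
    then have "ereal growth \<le> hausdorff_dim ({} :: (real \<times> real) set)"
      using hausdorff_dim_critical_line[of s c, OF crit] by simp
    also have "\<dots> \<le> 0" by (rule hausdorff_dim_subsingleton) simp
    finally show False using growth_pos by simp
  qed
  then obtain a where "a \<in> {0..1}" and Ta: "T a = s * a + c"
    unfolding graph_Int_line by blast
  then have a: "(a, T a) \<in> takagi_graph lam" by (auto simp: takagi_graph_def)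
  have "(\<lambda>v. v + (a, T a)) ` line s 0 = line s c" using Ta by (simp add: line_translate)
  then have "ereal growth \<le> hausdorff_dim (takagi_graph lam \<inter> (\<lambda>v. v + (a, T a)) ` line s 0)"
    using hausdorff_dim_critical_line[of s c, OF crit] by simp
  moreover have "line s 0 \<in> RP1" by (auto simp: RP1_iff)
  ultimately have "\<exists>x\<in>takagi_graph lam. \<exists>V\<in>RP1. hausdorff_dim (takagi_graph lam \<inter> (\<lambda>v. v + x) ` V) = ereal growth"
    using a upper by (metis antisym)
  then show ?thesis unfolding dim using upper growth_less_1 by simp
qed

end
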